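(* Let $\nu=N(0,\sigma^2\mathbf{I}_d)*\rho$ with $\sigma>0$, where $\rho$ is a probability measure supported on a Euclidean ball of radius $R$ in $\mathbb{R}^d$ (so $\nu$ is absolutely continuous with finite second moment). Let $X_1$ be the time-one flow map of the Gaussian interpolation flow and $X_1^*$ the time-one map of the time-reversed flow. Then $X_1$ is a Lipschitz mapping, that is, $$\|\nabla_xX_1(x)\|_{2,2}\le\frac{\sigma}{\sqrt{a_0^2+\sigma^2b_0^2}}\exp\left(\frac{a_0^2}{a_0^2+\sigma^2b_0^2}\cdot\frac{R^2}{2\sigma^2}\right),\quad\forall x\in\mathbb{R}^d.$$ In particular, if $a_0=1$ and $b_0=0$, then $\|\nabla_xX_1(x)\|_{2,2}\le\sigma\exp\left(\frac{R^2}{2\sigma^2}\right)$ for all $x\in\mathbb{R}^d$. Moreover, $X_1^*$ is a Lipschitz mapping, that is, $$\|\nabla_xX_1^*(x)\|_{2,2}\le\sqrt{\sigma^{-2}a_0^2+b_0^2},\quad\forall x\in\mathrm{supp}(\nu).$$ In particular, if $a_0=1$ and $b_0=0$, then $\|\nabla_xX_1^*(x)\|_{2,2}\le\frac1\sigma$ for all $x\in\mathrm{supp}(\nu)$.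
   Context: Fix functions $a_t,b_t$ of $t\in[0,1]$ (a dot denotes the time derivative) satisfying: $\dot a_t\le 0$, $\dot b_t\ge 0$, $a_0>0$, $b_0\ge 0$, $a_1=0$, $b_1=1$; $a_t>0$ and $b_t>0$ for all $t\in(0,1)$; $a_t,b_t\in C^2([0,1))$, $a_t^2\in C^1([0,1])$, $b_t\in C^1([0,1])$. Let $\mathsf{Z}\sim N(0,\mathbf{I}_d)$ and $\mathsf{X}_1\sim\nu$ be independent, and $\mathsf{X}_t=a_t\mathsf{Z}+b_t\mathsf{X}_1$. The velocity field is $v(t,x)=\mathbb{E}[\dot a_t\mathsf{Z}+\dot b_t\mathsf{X}_1\mid\mathsf{X}_t=x]$ for $t\in(0,1)$, $v(0,x)=\lim_{t\downarrow0}v(t,x)$, $v(1,x)=\lim_{t\uparrow1}v(t,x)$. The Gaussian interpolation flow is the solution $X_t(x)$ of $\frac{d}{dt}X_t(x)=v(t,X_t(x))$, $X_0(x)=x$, $t\in[0,1]$; the time-reversed flow is the solution $X_t^*(x)$ of $\frac{d}{dt}X_t^*(x)=-v(1-t,X_t^*(x))$, $X_0^*(x)=x$, $t\in[0,1]$. $\|\cdot\|_{2,2}$ is the spectral norm. *)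

theory Defs
  imports "HOL-Probability.Probability"
begin

text \<open>
  On an interval \<open>S\<close> with more than one point, derivatives are taken relative to \<open>S\<close>, so they are
  one-sided at those endpoints that belong to \<open>S\<close>.
\<close>

definition C1_on :: "real set \<Rightarrow> (real \<Rightarrow> real) \<Rightarrow> bool" where
  "C1_on S f \<longleftrightarrow>
    (\<exists>f'. continuous_on S f' \<and> (\<forall>t\<in>S. (f has_real_derivative f' t) (at t within S)))"

definition C2_on :: "real set \<Rightarrow> (real \<Rightarrow> real) \<Rightarrow> bool" where
  "C2_on S f \<longleftrightarrow>
    (\<exists>f'. C1_on S f' \<and> (\<forall>t\<in>S. (f has_real_derivative f' t) (at t within S)))"

text \<open>The time derivative on \<open>[0,1]\<close>; it agrees with \<^const>\<open>deriv\<close> on \<open>(0,1)\<close>.\<close>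

definition time_deriv :: "(real \<Rightarrow> real) \<Rightarrow> real \<Rightarrow> real" where
  "time_deriv f t = vector_derivative f (at t within {0..1})"

text \<open>
  The function \<open>a\<close> need not be differentiable at time 1 (only \<open>a\<^sup>2\<close> is), for example
  \<open>a t = sqrt (1 - t\<^sup>2)\<close>; its sign condition is therefore imposed on \<open>[0,1)\<close>.
\<close>

definition interpolation_coeffs :: "(real \<Rightarrow> real) \<Rightarrow> (real \<Rightarrow> real) \<Rightarrow> bool" where
  "interpolation_coeffs a b \<longleftrightarrow>
     (\<forall>t\<in>{0..<1}. time_deriv a t \<le> 0) \<and> (\<forall>t\<in>{0..1}. time_deriv b t \<ge> 0) \<and>
     a 0 > 0 \<and> b 0 \<ge> 0 \<and> a 1 = 0 \<and> b 1 = 1 \<and>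
     (\<forall>t\<in>{0<..<1}. a t > 0 \<and> b t > 0) \<and>
     C2_on {0..<1} a \<and> C2_on {0..<1} b \<and>
     C1_on {0..1} (\<lambda>t. (a t)\<^sup>2) \<and> C1_on {0..1} b"

text \<open>The Gaussian measure \<open>N(0, s\<^sup>2 I)\<close>, for \<open>s > 0\<close>.\<close>

definition gaussian :: "real \<Rightarrow> (real ^ 'n) measure" where
  "gaussian s = density lborel
     (\<lambda>x. ennreal (exp (- (norm x)\<^sup>2 / (2 * s\<^sup>2)) / sqrt (2 * pi * s\<^sup>2) ^ CARD('n)))"

definition supp :: "'a::topological_space measure \<Rightarrow> 'a set" where
  "supp \<mu> = {x. \<forall>U. open U \<longrightarrow> x \<in> U \<longrightarrow> emeasure \<mu> U > 0}"

definition interpolant ::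
  "(real \<Rightarrow> real) \<Rightarrow> (real \<Rightarrow> real) \<Rightarrow> ('w \<Rightarrow> real ^ 'n) \<Rightarrow> ('w \<Rightarrow> real ^ 'n) \<Rightarrow> real \<Rightarrow> 'w \<Rightarrow> real ^ 'n"
where
  "interpolant a b Z X1 t \<omega> = a t *\<^sub>R Z \<omega> + b t *\<^sub>R X1 \<omega>"

text \<open>
  Conditioning on the value of the interpolant is expressed through conditional expectation, taken
  componentwise, given the sigma-algebra it generates. This determines \<open>v t\<close> only up to null sets
  of the law of the interpolant; as that law has a positive density for \<open>0 < t < 1\<close>, requiring
  \<open>v t\<close> to be continuous makes it unique at every point.
\<close>

definition velocity_field ::
  "'w measure \<Rightarrow> (real \<Rightarrow> real) \<Rightarrow> (real \<Rightarrow> real) \<Rightarrow> ('w \<Rightarrow> real ^ 'n) \<Rightarrow> ('w \<Rightarrow> real ^ 'n) \<Rightarrow>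
   (real \<Rightarrow> real ^ 'n \<Rightarrow> real ^ 'n) \<Rightarrow> bool"
where
  "velocity_field M a b Z X1 v \<longleftrightarrow>
     (\<forall>t\<in>{0<..<1}. continuous_on UNIV (v t) \<and>
        (\<forall>i. AE \<omega> in M. v t (interpolant a b Z X1 t \<omega>) $ i =
           real_cond_exp M (vimage_algebra (space M) (interpolant a b Z X1 t) borel)
             (\<lambda>\<omega>. (time_deriv a t *\<^sub>R Z \<omega> + time_deriv b t *\<^sub>R X1 \<omega>) $ i) \<omega>)) \<and>
     (\<forall>x. ((\<lambda>t. v t x) \<longlongrightarrow> v 0 x) (at_right 0)) \<and>
     (\<forall>x. ((\<lambda>t. v t x) \<longlongrightarrow> v 1 x) (at_left 1))"

definition is_flow ::
  "(real \<Rightarrow> 'a \<Rightarrow> 'a) \<Rightarrow> (real \<Rightarrow> 'a \<Rightarrow> 'a::real_normed_vector) \<Rightarrow> bool"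
where
  "is_flow w X \<longleftrightarrow>
     (\<forall>x. X 0 x = x \<and>
        (\<forall>t\<in>{0..1}. ((\<lambda>s. X s x) has_vector_derivative w t (X t x)) (at t within {0..1})))"

definition spectral_norm :: "real ^ 'n ^ 'm \<Rightarrow> real" where
  "spectral_norm A = onorm (\<lambda>x. A *v x)"

end

theory Submission
  imports Defs
begin

text \<open>
  Write \<open>\<nu>\<close> as the law of \<open>\<sigma> W + Y\<close> and put \<open>A = a\<^sup>2 + \<sigma>\<^sup>2 b\<^sup>2\<close>. Given \<open>Y\<close>, the pair \<open>(X\<^sub>t, Z)\<close> is Gaussian, and
  completing the square yields \<open>v(t,x) = \<alpha> x + \<beta> m(t,x)\<close> with \<open>\<alpha> = A'/(2A)\<close>,
  \<open>\<beta> = (a\<^sup>2 b' - a a' b)/A \<ge> 0\<close> and \<open>m(t,x)\<close> the mean of a measure on the ball of radius \<open>R\<close>,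
  exponentially tilted by \<open>(b/A) x\<close>. The derivative of a tilted mean is a covariance, which lies
  between \<open>0\<close> and \<open>R\<^sup>2 I\<close>; hence \<open>\<alpha> I \<le> \<nabla>v \<le> (\<alpha> + R\<^sup>2 \<beta> b/A) I\<close>. Both bounds are exact time derivatives,
  since \<open>(b\<^sup>2/A)' = 2 \<beta> b/A\<close>, and Gronwall's inequality gives the Lipschitz constants.
\<close>

section \<open>Flows of one-sided Lipschitz vector fields\<close>

text \<open>Three obstacles shape the proof. The coefficient \<open>a\<close> may fail to be
  differentiable at time 1, so differential inequalities are used on the open interval only, with
  continuity on the closed one, and time-dependent bounds always occur as derivatives of continuous
  functions whose increments are what enters. The field \<open>v\<close> is known only through
  conditional expectations, hence up to null sets; continuity of \<open>v t\<close> and the positive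
  density of the interpolant are needed to obtain a formula at every point. Finally, a Lipschitz
  bound controls the Jacobian only where the derivative exists, and the flow is given merely as a
  solution. Differentiability of the time-one map is therefore proved separately, from a quadratic
  Taylor remainder of \<open>v\<close> valid for all increments. The constants in that remainder are
  crude but never reach the Lipschitz constants, which come from the one-sided bounds alone.\<close>

lemma gronwall_inequality:
  fixes f \<theta> \<theta>' k k' :: "real \<Rightarrow> real"
  assumes T: "0 \<le> T"
    and cont: "continuous_on {0..T} f" "continuous_on {0..T} \<theta>" "continuous_on {0..T} k"
    and f: "\<And>t. 0 < t \<Longrightarrow> t < T \<Longrightarrow> (f has_real_derivative f' t) (at t)"
    and \<theta>: "\<And>t. 0 < t \<Longrightarrow> t < T \<Longrightarrow> (\<theta> has_real_derivative \<theta>' t) (at t)"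
    and k: "\<And>t. 0 < t \<Longrightarrow> t < T \<Longrightarrow> (k has_real_derivative k' t) (at t)"
    and k'_nonneg: "\<And>t. 0 < t \<Longrightarrow> t < T \<Longrightarrow> 0 \<le> k' t"
    and le: "\<And>t. 0 < t \<Longrightarrow> t < T \<Longrightarrow> f' t \<le> \<theta>' t * f t + k' t * D"
    and C: "\<And>t. 0 < t \<Longrightarrow> t < T \<Longrightarrow> exp (- \<theta> t) \<le> C"
    and D: "0 \<le> D"
  shows "f T * exp (- \<theta> T) \<le> f 0 * exp (- \<theta> 0) + C * D * (k T - k 0)"
proof -
  \<comment> \<open>Multiplying by exp(-\<theta>) removes the homogeneous term, and the forcing is
    compensated by its own primitive \<open>k\<close>, so that \<open>h\<close> decreases. The size
    of \<open>k'\<close> enters only through the increment of \<open>k\<close>.\<close>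
  define h where "h t = f t * exp (- \<theta> t) - C * D * k t" for t
  have "h T \<le> h 0"
  proof (rule DERIV_nonpos_imp_decreasing_open[OF T])
    fix t assume t: "0 < t" "t < T"
    have "(h has_real_derivative (f' t - \<theta>' t * f t) * exp (- \<theta> t) - C * D * k' t) (at t)"
      unfolding h_def
      by (auto intro!: derivative_eq_intros f \<theta> k t simp: algebra_simps)
    moreover have "(f' t - \<theta>' t * f t) * exp (- \<theta> t) \<le> (k' t * D) * exp (- \<theta> t)"
      using le[OF t] by (intro mult_right_mono) auto
    moreover have "\<dots> \<le> (k' t * D) * C"
      using k'_nonneg[OF t] C[OF t] D by (intro mult_left_mono) auto
    ultimately show "\<exists>y. DERIV h t :> y \<and> y \<le> 0"
      by (intro exI[of _ "(f' t - \<theta>' t * f t) * exp (- \<theta> t) - C * D * k' t"]) (auto simp: algebra_simps)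
  next
    show "continuous_on {0..T} h"
      unfolding h_def by (intro continuous_intros cont)
  qed
  then show ?thesis by (simp add: h_def algebra_simps)
qed

lemma has_real_derivative_norm_power2:
  fixes E :: "real \<Rightarrow> 'a::real_inner"
  assumes "(E has_vector_derivative E') (at t)"
  shows "((\<lambda>s. (norm (E s))\<^sup>2) has_real_derivative 2 * (E' \<bullet> E t)) (at t)"
proof -
  have E: "(E has_derivative (\<lambda>x. x *\<^sub>R E')) (at t)"
    using assms by (simp add: has_vector_derivative_def)
  have "((\<lambda>s. E s \<bullet> E s) has_derivative (\<lambda>x. E t \<bullet> (x *\<^sub>R E') + (x *\<^sub>R E') \<bullet> E t)) (at t)"
    by (rule has_derivative_inner[OF E E])
  moreover have "(\<lambda>x. E t \<bullet> (x *\<^sub>R E') + (x *\<^sub>R E') \<bullet> E t) = (*) (2 * (E' \<bullet> E t))"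
    by (auto simp: inner_commute algebra_simps)
  ultimately show ?thesis
    by (simp add: has_field_derivative_def power2_norm_eq_inner)
qed

lemma has_derivative_quadratic_remainder:
  fixes f :: "'a::real_normed_vector \<Rightarrow> 'b::real_normed_vector"
  assumes "bounded_linear D" and "\<And>h. norm (f (x + h) - f x - D h) \<le> C * (norm h)\<^sup>2"
  shows "(f has_derivative D) (at x)"
proof (rule has_derivativeI_sandwich[of 1])
  show "norm ((f y - f x) - D (y - x)) / norm (y - x) \<le> C * norm (y - x)" if "y \<noteq> x" for y
    using assms(2)[of "y - x"] that by (simp add: divide_simps power2_eq_square mult.assoc)
  have "((\<lambda>y. C * norm (y - x)) \<longlongrightarrow> C * norm (x - x)) (at x)"
    by (intro tendsto_intros)
  then show "((\<lambda>y. C * norm (y - x)) \<longlongrightarrow> 0) (at x)" by simp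
qed (use assms in auto)

text \<open>Bounding the inner product rather than the norm of \<open>G t y - G t x\<close> keeps
  the sign of \<open>\<theta>'\<close>, so contraction is recorded as well as expansion. The forward
  and the reversed flow are both instances, with different \<open>G\<close> and \<theta>.\<close>

locale one_sided_flow =
  fixes G :: "real \<Rightarrow> 'a::euclidean_space \<Rightarrow> 'a" and u :: "real \<Rightarrow> 'a \<Rightarrow> 'a"
    and \<theta> \<theta>' :: "real \<Rightarrow> real"
  assumes start: "u 0 x = x"
    and cont: "continuous_on {0..1} (\<lambda>t. u t x)"
    and deriv: "0 < t \<Longrightarrow> t < 1 \<Longrightarrow> ((\<lambda>s. u s x) has_vector_derivative G t (u t x)) (at t)"
    and \<theta>_cont: "continuous_on {0..1} \<theta>"
    and \<theta>_deriv: "0 < t \<Longrightarrow> t < 1 \<Longrightarrow> (\<theta> has_real_derivative \<theta>' t) (at t)"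
    and one_sided: "0 < t \<Longrightarrow> t < 1 \<Longrightarrow> (G t y - G t x) \<bullet> (y - x) \<le> \<theta>' t * (norm (y - x))\<^sup>2"
begin

lemma flow_dist_le:
  assumes t: "0 \<le> t" "t \<le> 1"
  shows "norm (u t y - u t x) \<le> exp (\<theta> t - \<theta> 0) * norm (y - x)"
proof -
  let ?E = "\<lambda>s. u s y - u s x"
  have sub: "{0..t} \<subseteq> {0..1}" using t by auto
  \<comment> \<open>There is no forcing, so \<open>k\<close> and \<open>D\<close> are zero and any
    upper bound of exp(-2 \<theta>) serves as \<open>C\<close>; compactness supplies one.\<close>
  have "(norm (?E t))\<^sup>2 * exp (- (2 * \<theta> t))
      \<le> (norm (?E 0))\<^sup>2 * exp (- (2 * \<theta> 0)) + (SUP s\<in>{0..1}. exp (- (2 * \<theta> s))) * 0 * (0 - 0)"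
  proof (rule gronwall_inequality[where f' = "\<lambda>s. 2 * ((G s (u s y) - G s (u s x)) \<bullet> ?E s)"
        and \<theta>' = "\<lambda>s. 2 * \<theta>' s" and k = "\<lambda>_. 0" and k' = "\<lambda>_. 0"])
    show "continuous_on {0..t} (\<lambda>s. (norm (?E s))\<^sup>2)"
      by (intro continuous_intros continuous_on_subset[OF cont sub])
    show "continuous_on {0..t} (\<lambda>s. 2 * \<theta> s)"
      by (intro continuous_intros continuous_on_subset[OF \<theta>_cont sub])
    show "((\<lambda>s. (norm (?E s))\<^sup>2) has_real_derivative
        2 * ((G s (u s y) - G s (u s x)) \<bullet> ?E s)) (at s)" if "0 < s" "s < t" for s
      using that t by (intro has_real_derivative_norm_power2 has_vector_derivative_diff deriv) auto
    show "((\<lambda>s. 2 * \<theta> s) has_real_derivative 2 * \<theta>' s) (at s)" if "0 < s" "s < t" for s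
      using that t by (intro DERIV_cmult \<theta>_deriv) auto
    show "2 * ((G s (u s y) - G s (u s x)) \<bullet> ?E s) \<le> 2 * \<theta>' s * (norm (?E s))\<^sup>2 + 0 * 0"
      if "0 < s" "s < t" for s
      using one_sided[of s "u s y" "u s x"] that t by simp
    show "exp (- (2 * \<theta> s)) \<le> (SUP s\<in>{0..1}. exp (- (2 * \<theta> s)))" if "0 < s" "s < t" for s
      using that t
      by (intro cSUP_upper bounded_imp_bdd_above compact_imp_bounded compact_continuous_image
          continuous_intros \<theta>_cont) auto
  qed (use t in auto)
  then have "(norm (?E t))\<^sup>2 \<le> (norm (y - x))\<^sup>2 * exp (- (2 * \<theta> 0)) * exp (2 * \<theta> t)"
    by (simp add: start exp_minus field_simps)
  also have "\<dots> = (exp (\<theta> t - \<theta> 0) * norm (y - x))\<^sup>2"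
    by (simp add: exp_diff exp_minus exp_double[of "\<theta> t"] exp_double[of "\<theta> 0"] power_mult_distrib power_divide
        power_inverse divide_inverse)
  finally show ?thesis
    by (rule power2_le_imp_le) auto
qed

text \<open>Energy estimate for a linearised equation with forcing \<open>r\<close> and zero initial
  value. What matters is the order of quantifiers: \<open>C\<close> is fixed before
  \<open>E\<close>, \<open>r\<close> and \<open>B\<close>, so the estimate is linear in
  \<open>B\<close> and survives a limit in which part of the forcing disappears.\<close>

lemma linearised_bound:
  fixes k k' :: "real \<Rightarrow> real" and L :: "real \<Rightarrow> 'a \<Rightarrow> 'a"
  assumes k: "continuous_on {0..1} k"
      "\<And>t. 0 < t \<Longrightarrow> t < 1 \<Longrightarrow> (k has_real_derivative k' t) (at t)"
      "\<And>t. 0 < t \<Longrightarrow> t < 1 \<Longrightarrow> 0 \<le> k' t"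
    and L: "\<And>t h. 0 < t \<Longrightarrow> t < 1 \<Longrightarrow> L t h \<bullet> h \<le> \<theta>' t * (norm h)\<^sup>2"
  obtains C where "0 \<le> C"
    "\<And>E r B. 0 \<le> B \<Longrightarrow> continuous_on {0..1} E \<Longrightarrow> E 0 = 0 \<Longrightarrow>
       (\<And>t. 0 < t \<Longrightarrow> t < 1 \<Longrightarrow> (E has_vector_derivative (L t (E t) + r t)) (at t)) \<Longrightarrow>
       (\<And>t. 0 < t \<Longrightarrow> t < 1 \<Longrightarrow> norm (r t) \<le> k' t * B) \<Longrightarrow> norm (E 1) \<le> C * B"
proof -
  have "bdd_above ((\<lambda>t. exp (- (2 * \<theta> t + k t))) ` {0..1})"
    by (intro bounded_imp_bdd_above compact_imp_bounded compact_continuous_image continuous_intros \<theta>_cont k) auto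
  then obtain C0 where C0: "\<And>t. t \<in> {0..1} \<Longrightarrow> exp (- (2 * \<theta> t + k t)) \<le> C0"
    unfolding bdd_above_def by blast
  define C where "C = sqrt (C0 * (k 1 - k 0) * exp (2 * \<theta> 1 + k 1))"
  have C0_pos: "0 < C0"
    using C0[of 0] exp_gt_zero[of "- (2 * \<theta> 0 + k 0)"] by (simp del: exp_gt_zero)
  have k_mono: "k 0 \<le> k 1"
    by (rule DERIV_nonneg_imp_increasing_open) (use k in auto)
  show thesis
  proof (rule that[of C])
    show "0 \<le> C" using C0_pos k_mono by (simp add: C_def)
    fix E :: "real \<Rightarrow> 'a" and r :: "real \<Rightarrow> 'a" and B :: real
    assume "0 \<le> B" and E: "continuous_on {0..1} E" "E 0 = 0"
        "\<And>t. 0 < t \<Longrightarrow> t < 1 \<Longrightarrow> (E has_vector_derivative (L t (E t) + r t)) (at t)"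
      and r: "\<And>t. 0 < t \<Longrightarrow> t < 1 \<Longrightarrow> norm (r t) \<le> k' t * B"
    have "(norm (E 1))\<^sup>2 * exp (- (2 * \<theta> 1 + k 1))
        \<le> (norm (E 0))\<^sup>2 * exp (- (2 * \<theta> 0 + k 0)) + C0 * B\<^sup>2 * (k 1 - k 0)"
    proof (rule gronwall_inequality[where f' = "\<lambda>t. 2 * ((L t (E t) + r t) \<bullet> E t)"
          and \<theta>' = "\<lambda>t. 2 * \<theta>' t + k' t" and k' = k'])
      fix t :: real assume t: "0 < t" "t < 1"
      show "((\<lambda>t. 2 * \<theta> t + k t) has_real_derivative 2 * \<theta>' t + k' t) (at t)"
        by (intro DERIV_add DERIV_cmult \<theta>_deriv k t)
      have "r t \<bullet> E t \<le> norm (r t) * norm (E t)" by (rule norm_cauchy_schwarz)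
      also have "\<dots> \<le> (k' t * B) * norm (E t)" by (intro mult_right_mono r t) auto
      finally have "2 * (r t \<bullet> E t) \<le> k' t * (2 * B * norm (E t))" by (simp add: algebra_simps)
      \<comment> \<open>The inequality 2 B |E| <= |E|^2 + B^2 splits the cross term into a part
        absorbed by the exponent, which is why the exponent is 2 \<theta> + k, and a forcing part
        that gives B^2 times the increment of \<open>k\<close>.\<close>
      also have "\<dots> \<le> k' t * ((norm (E t))\<^sup>2 + B\<^sup>2)"
        using sum_squares_bound[of B "norm (E t)"] k(3)[OF t] by (intro mult_left_mono) (auto simp: algebra_simps)
      finally show "2 * ((L t (E t) + r t) \<bullet> E t) \<le> (2 * \<theta>' t + k' t) * (norm (E t))\<^sup>2 + k' t * B\<^sup>2"
        using L[OF t, of "E t"] by (simp add: inner_add_left algebra_simps)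
    qed (use E k C0 in \<open>auto intro!: continuous_intros has_real_derivative_norm_power2 \<theta>_cont\<close>)
    then have "(norm (E 1))\<^sup>2 * exp (- (2 * \<theta> 1 + k 1)) * exp (2 * \<theta> 1 + k 1)
        \<le> C0 * B\<^sup>2 * (k 1 - k 0) * exp (2 * \<theta> 1 + k 1)"
      using E(2) by (intro mult_right_mono) auto
    then have "(norm (E 1))\<^sup>2 \<le> C0 * B\<^sup>2 * (k 1 - k 0) * exp (2 * \<theta> 1 + k 1)"
      by (simp add: mult.assoc flip: exp_add)
    also have "\<dots> = (C * B)\<^sup>2"
      using C0_pos k_mono by (simp add: C_def power_mult_distrib algebra_simps)
    finally have "(norm (E 1))\<^sup>2 \<le> (C * B)\<^sup>2" .
    then show "norm (E 1) \<le> C * B"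
      using \<open>0 \<le> C\<close> \<open>0 \<le> B\<close> by (auto intro: power2_le_imp_le)
  qed
qed

text \<open>The derivative is assembled from subsequential limits of difference quotients in the
  basis directions. Once the step sizes tend to 0, this linear map differs from the true increment
  by an amount quadratic in the increment, so it is the derivative, and uniqueness of the limits
  need not be known beforehand.\<close>

lemma flow_differentiable:
  fixes k k' :: "real \<Rightarrow> real" and L :: "real \<Rightarrow> 'a \<Rightarrow> 'a \<Rightarrow> 'a"
  assumes k: "continuous_on {0..1} k"
      "\<And>t. 0 < t \<Longrightarrow> t < 1 \<Longrightarrow> (k has_real_derivative k' t) (at t)"
      "\<And>t. 0 < t \<Longrightarrow> t < 1 \<Longrightarrow> 0 \<le> k' t"
    and L: "\<And>t y. 0 < t \<Longrightarrow> t < 1 \<Longrightarrow> linear (L t y)"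
      "\<And>t y h. 0 < t \<Longrightarrow> t < 1 \<Longrightarrow> L t y h \<bullet> h \<le> \<theta>' t * (norm h)\<^sup>2"
    and remainder: "\<And>t y h. 0 < t \<Longrightarrow> t < 1 \<Longrightarrow> norm (G t (y + h) - G t y - L t y h) \<le> k' t * (norm h)\<^sup>2"
  shows "u 1 differentiable (at x)"
proof -
  define \<Delta> where "\<Delta> \<xi> t = u t (x + \<xi>) - u t x" for \<xi> t
  have "bdd_above ((\<lambda>t. exp (\<theta> t - \<theta> 0)) ` {0..1})"
    by (intro bounded_imp_bdd_above compact_imp_bounded compact_continuous_image continuous_intros \<theta>_cont) auto
  then obtain K where K: "\<And>t. t \<in> {0..1} \<Longrightarrow> exp (\<theta> t - \<theta> 0) \<le> K"
    unfolding bdd_above_def by blast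
  have "0 \<le> K" using K[of 0] by simp
  have \<Delta>_le: "norm (\<Delta> \<xi> t) \<le> K * norm \<xi>" if "0 \<le> t" "t \<le> 1" for \<xi> t
  proof -
    have "norm (\<Delta> \<xi> t) \<le> exp (\<theta> t - \<theta> 0) * norm \<xi>"
      using flow_dist_le[OF that, of "x + \<xi>" x] by (simp add: \<Delta>_def)
    also have "\<dots> \<le> K * norm \<xi>"
      using K[of t] that by (intro mult_right_mono) auto
    finally show ?thesis .
  qed
  define \<epsilon> where "\<epsilon> \<xi> t = G t (u t x + \<Delta> \<xi> t) - G t (u t x) - L t (u t x) (\<Delta> \<xi> t)" for \<xi> t
  have \<epsilon>_le: "norm (\<epsilon> \<xi> t) \<le> k' t * (K * norm \<xi>)\<^sup>2" if t: "0 < t" "t < 1" for \<xi> t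
  proof -
    have "norm (\<epsilon> \<xi> t) \<le> k' t * (norm (\<Delta> \<xi> t))\<^sup>2"
      unfolding \<epsilon>_def by (rule remainder[OF t])
    also have "\<dots> \<le> k' t * (K * norm \<xi>)\<^sup>2"
      using \<Delta>_le[of t \<xi>] t k(3)[OF t] by (intro mult_left_mono power_mono) auto
    finally show ?thesis .
  qed
  have \<Delta>_deriv: "(\<Delta> \<xi> has_vector_derivative L t (u t x) (\<Delta> \<xi> t) + \<epsilon> \<xi> t) (at t)"
    if t: "0 < t" "t < 1" for \<xi> t
    using has_vector_derivative_diff[OF deriv[OF t, of "x + \<xi>"] deriv[OF t, of x]]
    by (simp add: \<Delta>_def[abs_def] \<epsilon>_def)
  have \<Delta>_cont: "continuous_on {0..1} (\<Delta> \<xi>)" for \<xi>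
    unfolding \<Delta>_def[abs_def] by (intro continuous_intros cont)
  obtain C where C: "0 \<le> C" "\<And>E r B. 0 \<le> B \<Longrightarrow> continuous_on {0..1} E \<Longrightarrow> E 0 = 0 \<Longrightarrow>
       (\<And>t. 0 < t \<Longrightarrow> t < 1 \<Longrightarrow> (E has_vector_derivative (L t (u t x) (E t) + r t)) (at t)) \<Longrightarrow>
       (\<And>t. 0 < t \<Longrightarrow> t < 1 \<Longrightarrow> norm (r t) \<le> k' t * B) \<Longrightarrow> norm (E 1) \<le> C * B"
    by (rule linearised_bound[OF k, of "\<lambda>t. L t (u t x)"]) (use L(2) in \<open>simp_all, blast\<close>)
  \<comment> \<open>Up to a quadratic error, the increments solve the linearised equation along \<open>u t x\<close>. Comparing
    them with combinations of difference quotients avoids constructing a solution of that equation.\<close>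
  have approx: "norm (\<Delta> \<xi> 1 - (\<Sum>i\<in>Basis. (\<xi> \<bullet> i) *\<^sub>R (\<Delta> (h i *\<^sub>R i) 1 /\<^sub>R h i)))
      \<le> C * (K\<^sup>2 * ((norm \<xi>)\<^sup>2 + (\<Sum>i\<in>Basis. norm \<xi> * h i)))"
    if h: "\<And>i. i \<in> Basis \<Longrightarrow> 0 < h i" for \<xi> and h :: "'a \<Rightarrow> real"
  proof (rule C(2)[where E = "\<lambda>t. \<Delta> \<xi> t - (\<Sum>i\<in>Basis. (\<xi> \<bullet> i) *\<^sub>R (\<Delta> (h i *\<^sub>R i) t /\<^sub>R h i))"
        and r = "\<lambda>t. \<epsilon> \<xi> t - (\<Sum>i\<in>Basis. (\<xi> \<bullet> i) *\<^sub>R (\<epsilon> (h i *\<^sub>R i) t /\<^sub>R h i))"])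
    show "0 \<le> K\<^sup>2 * ((norm \<xi>)\<^sup>2 + (\<Sum>i\<in>Basis. norm \<xi> * h i))"
      using h by (intro mult_nonneg_nonneg add_nonneg_nonneg sum_nonneg) (auto simp: less_imp_le)
    show "continuous_on {0..1} (\<lambda>t. \<Delta> \<xi> t - (\<Sum>i\<in>Basis. (\<xi> \<bullet> i) *\<^sub>R (\<Delta> (h i *\<^sub>R i) t /\<^sub>R h i)))"
      by (intro continuous_intros \<Delta>_cont)
    have "(\<Sum>i\<in>Basis. (\<xi> \<bullet> i) *\<^sub>R (\<Delta> (h i *\<^sub>R i) 0 /\<^sub>R h i)) = (\<Sum>i\<in>Basis. (\<xi> \<bullet> i) *\<^sub>R i)"
      using h by (intro sum.cong) (force simp: \<Delta>_def start dest!: h)+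
    then show "\<Delta> \<xi> 0 - (\<Sum>i\<in>Basis. (\<xi> \<bullet> i) *\<^sub>R (\<Delta> (h i *\<^sub>R i) 0 /\<^sub>R h i)) = 0"
      by (simp add: \<Delta>_def start euclidean_representation)
  next
    fix t :: real assume t: "0 < t" "t < 1"
    interpret L: linear "L t (u t x)" using L(1)[OF t] .
    have "((\<lambda>t. \<Delta> \<xi> t - (\<Sum>i\<in>Basis. (\<xi> \<bullet> i) *\<^sub>R (\<Delta> (h i *\<^sub>R i) t /\<^sub>R h i))) has_vector_derivative
       (L t (u t x) (\<Delta> \<xi> t) + \<epsilon> \<xi> t) - (\<Sum>i\<in>Basis. (\<xi> \<bullet> i) *\<^sub>R
          ((L t (u t x) (\<Delta> (h i *\<^sub>R i) t) + \<epsilon> (h i *\<^sub>R i) t) /\<^sub>R h i))) (at t)"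
      by (intro has_vector_derivative_diff has_vector_derivative_sum
          bounded_linear.has_vector_derivative[OF bounded_linear_scaleR_right] \<Delta>_deriv t)
    also have "(L t (u t x) (\<Delta> \<xi> t) + \<epsilon> \<xi> t) - (\<Sum>i\<in>Basis. (\<xi> \<bullet> i) *\<^sub>R
          ((L t (u t x) (\<Delta> (h i *\<^sub>R i) t) + \<epsilon> (h i *\<^sub>R i) t) /\<^sub>R h i)) =
       L t (u t x) (\<Delta> \<xi> t - (\<Sum>i\<in>Basis. (\<xi> \<bullet> i) *\<^sub>R (\<Delta> (h i *\<^sub>R i) t /\<^sub>R h i))) +
       (\<epsilon> \<xi> t - (\<Sum>i\<in>Basis. (\<xi> \<bullet> i) *\<^sub>R (\<epsilon> (h i *\<^sub>R i) t /\<^sub>R h i)))"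
      by (simp add: L.diff L.sum L.scaleR scaleR_add_right sum.distrib)
    finally show "((\<lambda>t. \<Delta> \<xi> t - (\<Sum>i\<in>Basis. (\<xi> \<bullet> i) *\<^sub>R (\<Delta> (h i *\<^sub>R i) t /\<^sub>R h i))) has_vector_derivative
       L t (u t x) (\<Delta> \<xi> t - (\<Sum>i\<in>Basis. (\<xi> \<bullet> i) *\<^sub>R (\<Delta> (h i *\<^sub>R i) t /\<^sub>R h i))) +
       (\<epsilon> \<xi> t - (\<Sum>i\<in>Basis. (\<xi> \<bullet> i) *\<^sub>R (\<epsilon> (h i *\<^sub>R i) t /\<^sub>R h i)))) (at t)" .
    have term_le: "norm ((\<xi> \<bullet> i) *\<^sub>R (\<epsilon> (h i *\<^sub>R i) t /\<^sub>R h i)) \<le> k' t * (K\<^sup>2 * (norm \<xi> * h i))"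
      if i: "i \<in> Basis" for i
    proof -
      have "norm ((\<xi> \<bullet> i) *\<^sub>R (\<epsilon> (h i *\<^sub>R i) t /\<^sub>R h i)) = \<bar>\<xi> \<bullet> i\<bar> * (norm (\<epsilon> (h i *\<^sub>R i) t) / h i)"
        using h[OF i] by (simp add: abs_mult divide_inverse mult_ac)
      also have "\<dots> \<le> norm \<xi> * (k' t * (K * h i)\<^sup>2 / h i)"
        using \<epsilon>_le[OF t, of "h i *\<^sub>R i"] h[OF i] i k(3)[OF t]
        by (intro mult_mono divide_right_mono Basis_le_norm) auto
      also have "\<dots> = k' t * (K\<^sup>2 * (norm \<xi> * h i))"
        using h[OF i] by (simp add: power2_eq_square)
      finally show ?thesis .
    qed
    have "norm (\<epsilon> \<xi> t - (\<Sum>i\<in>Basis. (\<xi> \<bullet> i) *\<^sub>R (\<epsilon> (h i *\<^sub>R i) t /\<^sub>R h i)))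
        \<le> norm (\<epsilon> \<xi> t) + (\<Sum>i\<in>Basis. norm ((\<xi> \<bullet> i) *\<^sub>R (\<epsilon> (h i *\<^sub>R i) t /\<^sub>R h i)))"
      by (intro order_trans[OF norm_triangle_ineq4] add_left_mono norm_sum)
    also have "\<dots> \<le> k' t * (K * norm \<xi>)\<^sup>2 + (\<Sum>i\<in>Basis. k' t * (K\<^sup>2 * (norm \<xi> * h i)))"
      by (intro add_mono \<epsilon>_le sum_mono term_le t)
    also have "\<dots> = k' t * (K\<^sup>2 * ((norm \<xi>)\<^sup>2 + (\<Sum>i\<in>Basis. norm \<xi> * h i)))"
      by (simp add: sum_distrib_left power_mult_distrib distrib_left)
    finally show "norm (\<epsilon> \<xi> t - (\<Sum>i\<in>Basis. (\<xi> \<bullet> i) *\<^sub>R (\<epsilon> (h i *\<^sub>R i) t /\<^sub>R h i)))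
        \<le> k' t * (K\<^sup>2 * ((norm \<xi>)\<^sup>2 + (\<Sum>i\<in>Basis. norm \<xi> * h i)))" .
  qed
  \<comment> \<open>The Lipschitz estimate keeps all difference quotients in a fixed ball, so
    compactness yields a limit along some sequence of positive step sizes, which may differ from one
    basis vector to the next.\<close>
  have "\<exists>h w. (\<forall>p. 0 < h p) \<and> h \<longlonglongrightarrow> 0 \<and> (\<lambda>p. \<Delta> (h p *\<^sub>R i) 1 /\<^sub>R h p) \<longlonglongrightarrow> w" if i: "i \<in> Basis" for i
  proof -
    let ?h = "\<lambda>p. inverse (real (Suc p))"
    have "\<forall>p. \<Delta> (?h p *\<^sub>R i) 1 /\<^sub>R ?h p \<in> cball 0 K"
    proof
      fix p
      have "norm (\<Delta> (?h p *\<^sub>R i) 1) \<le> K * ?h p"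
        using \<Delta>_le[of 1 "?h p *\<^sub>R i"] i by simp
      then show "\<Delta> (?h p *\<^sub>R i) 1 /\<^sub>R ?h p \<in> cball 0 K"
        by (simp only: mem_cball_0 norm_scaleR) (simp add: field_simps)
    qed
    moreover have "\<forall>f. (\<forall>p. f p \<in> cball (0::'a) K) \<longrightarrow> (\<exists>w\<in>cball 0 K. \<exists>r::nat \<Rightarrow> nat. strict_mono r \<and> (f \<circ> r) \<longlonglongrightarrow> w)"
      using compact_cball[of "0::'a" K] unfolding compact_def .
    ultimately obtain w r where "strict_mono (r :: nat \<Rightarrow> nat)" "((\<lambda>p. \<Delta> (?h p *\<^sub>R i) 1 /\<^sub>R ?h p) \<circ> r) \<longlonglongrightarrow> w"
      by (drule_tac spec[where x = "\<lambda>p. \<Delta> (?h p *\<^sub>R i) 1 /\<^sub>R ?h p"]) blast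
    moreover have "(?h \<circ> r) \<longlonglongrightarrow> 0"
      using LIMSEQ_inverse_real_of_nat \<open>strict_mono r\<close> by (rule LIMSEQ_subseq_LIMSEQ)
    ultimately show ?thesis
      by (intro exI[of _ "?h \<circ> r"] exI[of _ w]) (auto simp: o_def)
  qed
  then obtain h w where h: "\<And>i p. i \<in> Basis \<Longrightarrow> 0 < h i p" "\<And>i. i \<in> Basis \<Longrightarrow> h i \<longlonglongrightarrow> 0"
      and w: "\<And>i. i \<in> Basis \<Longrightarrow> (\<lambda>p. \<Delta> (h i p *\<^sub>R i) 1 /\<^sub>R h i p) \<longlonglongrightarrow> w i"
    by metis
  have "(u 1 has_derivative (\<lambda>\<xi>. \<Sum>i\<in>Basis. (\<xi> \<bullet> i) *\<^sub>R w i)) (at x)"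
  proof (rule has_derivative_quadratic_remainder)
    show "bounded_linear (\<lambda>\<xi>. \<Sum>i\<in>Basis. (\<xi> \<bullet> i) *\<^sub>R w i)"
      by (intro bounded_linear_intros)
    fix \<xi>
    have "norm (\<Delta> \<xi> 1 - (\<Sum>i\<in>Basis. (\<xi> \<bullet> i) *\<^sub>R w i)) \<le> C * (K\<^sup>2 * ((norm \<xi>)\<^sup>2 + (\<Sum>i\<in>(Basis::'a set). norm \<xi> * 0)))"
    proof (rule LIMSEQ_le)
      show "(\<lambda>p. norm (\<Delta> \<xi> 1 - (\<Sum>i\<in>Basis. (\<xi> \<bullet> i) *\<^sub>R (\<Delta> (h i p *\<^sub>R i) 1 /\<^sub>R h i p))))
          \<longlonglongrightarrow> norm (\<Delta> \<xi> 1 - (\<Sum>i\<in>Basis. (\<xi> \<bullet> i) *\<^sub>R w i))"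
        by (intro tendsto_intros w)
      show "(\<lambda>p. C * (K\<^sup>2 * ((norm \<xi>)\<^sup>2 + (\<Sum>i\<in>Basis. norm \<xi> * h i p))))
          \<longlonglongrightarrow> C * (K\<^sup>2 * ((norm \<xi>)\<^sup>2 + (\<Sum>i\<in>(Basis::'a set). norm \<xi> * 0)))"
        by (intro tendsto_intros h)
    qed (use approx h in auto)
    then show "norm (u 1 (x + \<xi>) - u 1 x - (\<Sum>i\<in>Basis. (\<xi> \<bullet> i) *\<^sub>R w i)) \<le> (C * K\<^sup>2) * (norm \<xi>)\<^sup>2"
      by (simp add: \<Delta>_def)
  qed
  then show ?thesis by (rule differentiableI)
qed

end

section \<open>Exponential tilting of compactly supported measures\<close>

text \<open>The Esscher transform, that is, the exponential family with base \<open>M\<close> and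
  natural parameter \<theta>. The normalisation allows a base that is not a probability measure, as
  is the case for the weighted measure \<open>posterior_base\<close>.\<close>

definition tilt :: "'a::euclidean_space measure \<Rightarrow> 'a \<Rightarrow> 'a measure" where
  "tilt M \<theta> = density M (\<lambda>y. ennreal (exp (\<theta> \<bullet> y) / (\<integral>z. exp (\<theta> \<bullet> z) \<partial>M)))"

definition mean :: "'a::euclidean_space measure \<Rightarrow> 'a" where
  "mean M = (\<integral>y. y \<partial>M)"

definition covariance :: "'a::euclidean_space measure \<Rightarrow> 'a \<Rightarrow> 'a" where
  "covariance M h = (\<integral>y. (h \<bullet> (y - mean M)) *\<^sub>R (y - mean M) \<partial>M)"

lemma abs_exp_minus_one_le: "\<bar>exp x - 1\<bar> \<le> \<bar>x\<bar> * exp \<bar>x\<bar>" for x :: real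
proof -
  obtain t where t: "\<bar>t\<bar> \<le> \<bar>x\<bar>" "exp x = (\<Sum>m<1. x ^ m / fact m) + exp t / fact 1 * x ^ 1"
    using Maclaurin_exp_le by blast
  then have "\<bar>exp x - 1\<bar> = \<bar>x\<bar> * exp t" by (simp add: abs_mult)
  also have "\<dots> \<le> \<bar>x\<bar> * exp \<bar>x\<bar>" using t(1) by (intro mult_left_mono) auto
  finally show ?thesis .
qed

lemma abs_exp_minus_linear_le: "\<bar>exp x - 1 - x\<bar> \<le> x\<^sup>2 * exp \<bar>x\<bar>" for x :: real
proof -
  obtain t where t: "\<bar>t\<bar> \<le> \<bar>x\<bar>" "exp x = (\<Sum>m<2. x ^ m / fact m) + exp t / fact 2 * x ^ 2"
    using Maclaurin_exp_le by blast
  then have "\<bar>exp x - 1 - x\<bar> = x\<^sup>2 * (exp t / 2)" by (simp add: abs_mult numeral_2_eq_2)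
  also have "\<dots> \<le> x\<^sup>2 * exp \<bar>x\<bar>"
  proof (intro mult_left_mono)
    have "exp t \<le> exp \<bar>x\<bar>" using t(1) by simp
    then show "exp t / 2 \<le> exp \<bar>x\<bar>" using exp_gt_zero[of t] by linarith
  qed simp
  finally show ?thesis .
qed

text \<open>Only a finite non-null measure is required, because the locale is used both for
  unnormalised base measures and for their tilts. The centre of the ball is arbitrary, and the
  constants obtained depend on its radius alone.\<close>

locale bounded_support = finite_measure M for M :: "'a::euclidean_space measure" +
  fixes c :: 'a and R :: real
  assumes sets_eq [simp, measurable_cong]: "sets M = sets borel"
    and AE_cball: "AE y in M. y \<in> cball c R"
    and nonnull: "emeasure M (space M) \<noteq> 0"
begin

lemma space_eq: "space M = UNIV"
  using sets_eq_imp_space_eq[OF sets_eq] by simp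

lemma R_nonneg: "0 \<le> R"
proof (rule ccontr)
  assume "\<not> 0 \<le> R"
  then have "AE y in M. False" using AE_cball by simp
  then show False using nonnull by (simp add: eventually_False ae_filter_eq_bot_iff)
qed

lemma integrable_bdd:
  fixes f :: "'a \<Rightarrow> 'b::{banach, second_countable_topology}"
  assumes [measurable]: "f \<in> borel_measurable borel" and "\<And>y. y \<in> cball c R \<Longrightarrow> norm (f y) \<le> B"
  shows "integrable M f"
  by (rule integrable_const_bound[where B = B]) (use AE_cball assms in \<open>auto elim: AE_mp\<close>)

lemma integrable_cont:
  fixes f :: "'a \<Rightarrow> 'b::euclidean_space"
  assumes "continuous_on UNIV f"
  shows "integrable M f"
proof -
  have "bounded (f ` cball c R)"
    by (intro compact_imp_bounded compact_continuous_image continuous_on_subset[OF assms]) auto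
  then obtain B where "\<And>y. y \<in> cball c R \<Longrightarrow> norm (f y) \<le> B"
    unfolding bounded_iff by blast
  with assms show ?thesis
    by (intro integrable_bdd) (auto intro: borel_measurable_continuous_onI)
qed

lemma norm_integral_le:
  fixes f :: "'a \<Rightarrow> 'b::euclidean_space"
  assumes "prob_space M" "continuous_on UNIV f" "\<And>y. y \<in> cball c R \<Longrightarrow> norm (f y) \<le> B"
  shows "norm (\<integral>y. f y \<partial>M) \<le> B"
proof -
  interpret prob_space M by fact
  have "norm (\<integral>y. f y \<partial>M) \<le> (\<integral>y. norm (f y) \<partial>M)" by (rule integral_norm_bound)
  also have "\<dots> \<le> (\<integral>y. B \<partial>M)"
    using assms(2) by (intro integral_mono_AE integrable_cont continuous_intros)
      (use AE_cball assms(3) in \<open>auto elim: AE_mp\<close>)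
  finally show ?thesis by (simp add: prob_space)
qed

lemma integral_ge:
  fixes f :: "'a \<Rightarrow> real"
  assumes "prob_space M" "continuous_on UNIV f" "\<And>y. y \<in> cball c R \<Longrightarrow> B \<le> f y"
  shows "B \<le> (\<integral>y. f y \<partial>M)"
proof -
  interpret prob_space M by fact
  have "(\<integral>y. B \<partial>M) \<le> (\<integral>y. f y \<partial>M)"
    using assms(2) by (intro integral_mono_AE integrable_cont continuous_intros)
      (use AE_cball assms(3) in \<open>auto elim: AE_mp\<close>)
  then show ?thesis by (simp add: prob_space)
qed

lemma integral_exp_pos: "0 < (\<integral>y. exp (\<theta> \<bullet> y) \<partial>M)"
proof -
  have int: "integrable M (\<lambda>y. exp (\<theta> \<bullet> y))"
    by (intro integrable_cont continuous_intros)
  have "(\<integral>y. exp (\<theta> \<bullet> y) \<partial>M) \<noteq> 0"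
  proof
    assume "(\<integral>y. exp (\<theta> \<bullet> y) \<partial>M) = 0"
    then have "AE y in M. False"
      by (subst (asm) integral_nonneg_eq_0_iff_AE[OF int]) auto
    then show False using nonnull by (simp add: eventually_False ae_filter_eq_bot_iff)
  qed
  moreover have "0 \<le> (\<integral>y. exp (\<theta> \<bullet> y) \<partial>M)" by simp
  ultimately show ?thesis by (simp only: less_le) simp
qed

lemma integral_tilt:
  fixes f :: "'a \<Rightarrow> 'b::euclidean_space"
  assumes "f \<in> borel_measurable borel"
  shows "(\<integral>y. f y \<partial>tilt M \<theta>) = (\<integral>y. exp (\<theta> \<bullet> y) *\<^sub>R f y \<partial>M) /\<^sub>R (\<integral>y. exp (\<theta> \<bullet> y) \<partial>M)"
proof -
  have "(\<integral>y. f y \<partial>tilt M \<theta>) = (\<integral>y. (exp (\<theta> \<bullet> y) / (\<integral>z. exp (\<theta> \<bullet> z) \<partial>M)) *\<^sub>R f y \<partial>M)"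
    unfolding tilt_def using assms integral_exp_pos[of \<theta>] by (intro integral_density) (auto simp: less_imp_le)
  also have "\<dots> = (\<integral>y. (exp (\<theta> \<bullet> y) *\<^sub>R f y) /\<^sub>R (\<integral>z. exp (\<theta> \<bullet> z) \<partial>M) \<partial>M)"
    by (simp add: divide_inverse mult_ac)
  finally show ?thesis by (simp only: integral_scaleR_right)
qed

lemma prob_space_tilt: "prob_space (tilt M \<theta>)"
proof
  let ?Z = "\<integral>y. exp (\<theta> \<bullet> y) \<partial>M"
  have "emeasure (tilt M \<theta>) (space (tilt M \<theta>)) = (\<integral>\<^sup>+y. ennreal (exp (\<theta> \<bullet> y) / ?Z) \<partial>M)"
    by (simp add: tilt_def emeasure_density space_eq)
  also have "\<dots> = ennreal (\<integral>y. exp (\<theta> \<bullet> y) / ?Z \<partial>M)"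
    using integral_exp_pos[of \<theta>]
    by (intro nn_integral_eq_integral integrable_cont continuous_intros) (auto simp: less_imp_le)
  also have "\<dots> = 1" using integral_exp_pos[of \<theta>] by simp
  finally show "emeasure (tilt M \<theta>) (space (tilt M \<theta>)) = 1" .
qed

lemma bounded_support_tilt: "bounded_support (tilt M \<theta>) c R"
proof -
  interpret T: prob_space "tilt M \<theta>" by (rule prob_space_tilt)
  show ?thesis
  proof
    show "sets (tilt M \<theta>) = sets borel" by (simp add: tilt_def)
    show "AE y in tilt M \<theta>. y \<in> cball c R"
      unfolding tilt_def by (subst AE_density) (use AE_cball in \<open>auto elim: AE_mp\<close>)
    show "emeasure (tilt M \<theta>) (space (tilt M \<theta>)) \<noteq> 0" by (simp add: T.emeasure_space_1)
  qed
qed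

text \<open>The exponential weights multiply and the normalising constants telescope. This reduces
  the expansion of the tilted mean at an arbitrary parameter to the expansion at 0, applied to an
  already tilted measure.\<close>

lemma tilt_tilt: "tilt (tilt M \<theta>) h = tilt M (\<theta> + h)"
proof -
  let ?Z = "\<integral>y. exp (\<theta> \<bullet> y) \<partial>M" and ?Z' = "\<integral>y. exp ((\<theta> + h) \<bullet> y) \<partial>M"
  have Z: "(\<integral>y. exp (h \<bullet> y) \<partial>tilt M \<theta>) = ?Z' / ?Z"
    by (subst integral_tilt) (simp_all add: inner_add_left exp_add divide_inverse mult.commute)
  have "tilt (tilt M \<theta>) h = density M (\<lambda>y. ennreal (exp (\<theta> \<bullet> y) / ?Z) * ennreal (exp (h \<bullet> y) / (?Z' / ?Z)))"
    unfolding tilt_def[of "tilt M \<theta>"] Z unfolding tilt_def by (rule density_density_eq) simp_all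
  also have "\<dots> = tilt M (\<theta> + h)"
    unfolding tilt_def using integral_exp_pos[of \<theta>] integral_exp_pos[of "\<theta> + h"]
    by (intro density_cong) (auto simp: ennreal_mult'[symmetric] inner_add_left exp_add less_imp_le)
  finally show ?thesis .
qed

lemma mean_mem_cball:
  assumes "prob_space M"
  shows "mean M \<in> cball c R"
proof -
  interpret prob_space M by fact
  have "norm (\<integral>y. y - c \<partial>M) \<le> R"
    by (intro norm_integral_le assms continuous_intros) (auto simp: dist_norm norm_minus_commute)
  also have "(\<integral>y. y - c \<partial>M) = mean M - c"
    by (subst Bochner_Integration.integral_diff) (auto simp: mean_def prob_space intro!: integrable_cont continuous_intros)
  finally show ?thesis by (simp add: dist_norm norm_minus_commute)
qed

lemma linear_covariance: "linear (covariance M)"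
proof
  show "covariance M (h + k) = covariance M h + covariance M k" for h k
    unfolding covariance_def
    by (subst Bochner_Integration.integral_add[symmetric])
       (auto simp: inner_add_left scaleR_add_left intro!: integrable_cont continuous_intros)
  show "covariance M (r *\<^sub>R h) = r *\<^sub>R covariance M h" for r h
    unfolding covariance_def by (simp flip: integral_scaleR_right)
qed

text \<open>The variance of the projection to \<open>h\<close> is at most its second moment about
  any point. Choosing the centre \<open>c\<close> instead of the mean yields the constant R^2, where
  bounding distances to the mean would only give 4 R^2.\<close>

lemma covariance_inner_bounds:
  assumes "prob_space M"
  shows "0 \<le> covariance M h \<bullet> h" and "covariance M h \<bullet> h \<le> R\<^sup>2 * (norm h)\<^sup>2"
proof -
  interpret prob_space M by fact
  let ?q = "\<lambda>y. h \<bullet> (y - c)"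
  have eq: "covariance M h \<bullet> h = (\<integral>y. (h \<bullet> (y - mean M))\<^sup>2 \<partial>M)"
    unfolding covariance_def
    by (subst integral_inner_left[symmetric])
       (auto simp: power2_eq_square inner_commute intro!: integrable_cont continuous_intros)
  then show "0 \<le> covariance M h \<bullet> h" by simp
  have int: "integrable M ?q" "integrable M (\<lambda>y. (?q y)\<^sup>2)"
    by (intro integrable_cont continuous_intros)+
  have int_y: "integrable M (\<lambda>y. y)"
    by (intro integrable_cont continuous_intros)
  have mean: "(\<integral>y. ?q y \<partial>M) = h \<bullet> (mean M - c)"
    unfolding mean_def using int_y by (simp add: inner_diff_right prob_space)
  have "(\<integral>y. (h \<bullet> (y - mean M))\<^sup>2 \<partial>M) = (\<integral>y. (?q y)\<^sup>2 - 2 * (h \<bullet> (mean M - c)) * ?q y + (h \<bullet> (mean M - c))\<^sup>2 \<partial>M)"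
    by (intro Bochner_Integration.integral_cong) (auto simp: inner_diff_right power2_eq_square algebra_simps)
  also have "\<dots> = (\<integral>y. (?q y)\<^sup>2 \<partial>M) - (h \<bullet> (mean M - c))\<^sup>2"
    using int mean by (simp add: prob_space power2_eq_square)
  also have "\<dots> \<le> norm (\<integral>y. (?q y)\<^sup>2 \<partial>M)" by simp
  also have "\<dots> \<le> R\<^sup>2 * (norm h)\<^sup>2"
  proof (intro norm_integral_le assms continuous_intros)
    fix y assume "y \<in> cball c R"
    then have "norm (y - c) \<le> R" by (simp add: dist_norm norm_minus_commute)
    then have "\<bar>?q y\<bar> \<le> norm h * R"
      by (intro order_trans[OF Cauchy_Schwarz_ineq2] mult_left_mono) auto
    then have "(?q y)\<^sup>2 \<le> (norm h * R)\<^sup>2" by (rule power2_le_iff_abs_le[THEN iffD2, rotated]) (use R_nonneg in auto)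
    then show "norm ((?q y)\<^sup>2) \<le> R\<^sup>2 * (norm h)\<^sup>2" by (simp add: power_mult_distrib mult.commute)
  qed
  finally show "covariance M h \<bullet> h \<le> R\<^sup>2 * (norm h)\<^sup>2" by (simp add: eq)
qed

lemma norm_diff_mean_le:
  assumes "prob_space M" "y \<in> cball c R"
  shows "norm (y - mean M) \<le> 2 * R"
  using mean_mem_cball[OF assms(1)] assms(2) dist_triangle_le[of y c "mean M" "2 * R"]
  by (simp add: dist_norm norm_minus_commute)

text \<open>A crude constant from |y - mean| <= 2 R; it is used only inside remainder estimates,
  where its size does not matter.\<close>

lemma norm_covariance_le:
  assumes "prob_space M"
  shows "norm (covariance M h) \<le> 4 * R\<^sup>2 * norm h"
  unfolding covariance_def
proof (intro norm_integral_le assms continuous_intros)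
  fix y assume "y \<in> cball c R"
  then have y: "norm (y - mean M) \<le> 2 * R" using assms by (rule norm_diff_mean_le[rotated])
  have "\<bar>h \<bullet> (y - mean M)\<bar> \<le> norm h * (2 * R)"
    using y by (intro order_trans[OF Cauchy_Schwarz_ineq2] mult_left_mono) auto
  then have "norm ((h \<bullet> (y - mean M)) *\<^sub>R (y - mean M)) \<le> (norm h * (2 * R)) * (2 * R)"
    using y R_nonneg unfolding norm_scaleR by (intro mult_mono) auto
  then show "norm ((h \<bullet> (y - mean M)) *\<^sub>R (y - mean M)) \<le> 4 * R\<^sup>2 * norm h"
    by (simp add: power2_eq_square mult_ac)
qed

text \<open>Writing the shift of the mean as a quotient N/D, the error is N/D - Cov h = ((N - Cov h)
  + (1 - D) Cov h)/D. The two terms are at most 2 R^3 exp(R) |h|^2 and 4 R^3 exp(R) |h|^2, and 1/D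
  <= exp(R), which produces the factor 6 R^3 exp(R)^2.\<close>

lemma mean_tilt_remainder_local:
  assumes M: "prob_space M" and h: "norm h \<le> 1"
  shows "norm (mean (tilt M h) - mean M - covariance M h) \<le> 6 * R ^ 3 * (exp R)\<^sup>2 * (norm h)\<^sup>2"
proof -
  interpret prob_space M by (rule M)
  let ?m = "mean M" and ?e = "\<lambda>y. h \<bullet> (y - c)"
  let ?Z = "\<integral>y. exp (h \<bullet> y) \<partial>M"
  \<comment> \<open>Centring the exponent at \<open>c\<close> extracts a common factor that cancels
    in the quotient; because |h| <= 1, the remaining exponent is at most \<open>R\<close> in
    absolute value on the ball.\<close>
  define D where "D = (\<integral>y. exp (?e y) \<partial>M)"
  define N where "N = (\<integral>y. exp (?e y) *\<^sub>R (y - ?m) \<partial>M)"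
  have e_abs: "\<bar>?e y\<bar> \<le> norm h * R" "\<bar>?e y\<bar> \<le> R" if "y \<in> cball c R" for y
  proof -
    have "norm (y - c) \<le> R" using that by (simp add: dist_norm norm_minus_commute)
    then show "\<bar>?e y\<bar> \<le> norm h * R"
      by (intro order_trans[OF Cauchy_Schwarz_ineq2] mult_left_mono) auto
    also have "\<dots> \<le> 1 * R" using h R_nonneg by (intro mult_right_mono) auto
    finally show "\<bar>?e y\<bar> \<le> R" by simp
  qed
  have int_y: "integrable M (\<lambda>y. y)" by (intro integrable_cont continuous_intros)
  have D_ge: "exp (- R) \<le> D" unfolding D_def
  proof (intro integral_ge M continuous_intros)
    fix y assume "y \<in> cball c R"
    then show "exp (- R) \<le> exp (?e y)" using e_abs(2)[of y] by simp
  qed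
  then have D_pos: "0 < D" using exp_gt_zero[of "- R"] by linarith
  have "mean (tilt M h) - ?m = N /\<^sub>R D"
  proof -
    have Z: "?Z = exp (h \<bullet> c) * D" 
    proof -
      have "exp (h \<bullet> c) * D = (\<integral>y. exp (h \<bullet> c) * exp (?e y) \<partial>M)"
        unfolding D_def by (rule integral_mult_right_zero[symmetric])
      then show ?thesis by (simp add: inner_diff_right flip: exp_add)
    qed
    have "(\<integral>y. exp (h \<bullet> y) *\<^sub>R (y - ?m) \<partial>M) = exp (h \<bullet> c) *\<^sub>R N" 
    proof -
      have "exp (h \<bullet> c) *\<^sub>R N = (\<integral>y. exp (h \<bullet> c) *\<^sub>R (exp (?e y) *\<^sub>R (y - ?m)) \<partial>M)"
        unfolding N_def by (rule integral_scaleR_right[symmetric])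
      then show ?thesis by (simp add: inner_diff_right flip: exp_add)
    qed
    moreover have "(\<integral>y. exp (h \<bullet> y) *\<^sub>R (y - ?m) \<partial>M) = (\<integral>y. exp (h \<bullet> y) *\<^sub>R y \<partial>M) - ?Z *\<^sub>R ?m"
      unfolding scaleR_diff_right
      by (subst Bochner_Integration.integral_diff)
         (auto intro!: integral_scaleR_left integrable_cont continuous_intros)
    moreover have "mean (tilt M h) = (\<integral>y. exp (h \<bullet> y) *\<^sub>R y \<partial>M) /\<^sub>R ?Z"
      unfolding mean_def by (rule integral_tilt) simp
    ultimately have "exp (h \<bullet> c) *\<^sub>R N = ?Z *\<^sub>R (mean (tilt M h) - ?m)"
      using integral_exp_pos[of h] by (simp add: scaleR_diff_right)
    then have "mean (tilt M h) - ?m = (exp (h \<bullet> c) *\<^sub>R N) /\<^sub>R ?Z"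
      using integral_exp_pos[of h] by simp
    then show ?thesis unfolding Z using D_pos by simp
  qed
  moreover have "norm (N - covariance M h) \<le> 2 * R ^ 3 * exp R * (norm h)\<^sup>2"
  proof -
    \<comment> \<open>Since \<open>y - ?m\<close> has integral zero, constants may be added to its
      weight: the covariance may be centred at \<open>c\<close>, and 1 may be subtracted from the
      exponential in \<open>N\<close>. The difference then starts at second order in
      \<open>h\<close>.\<close>
    have "covariance M h = (\<integral>y. ?e y *\<^sub>R (y - ?m) \<partial>M)"
    proof -
      have "(\<integral>y. (h \<bullet> (?m - c)) *\<^sub>R (y - ?m) \<partial>M) = 0"
        using int_y by (simp add: mean_def prob_space)
      moreover have "(\<integral>y. ?e y *\<^sub>R (y - ?m) \<partial>M) =
          (\<integral>y. (h \<bullet> (y - ?m)) *\<^sub>R (y - ?m) + (h \<bullet> (?m - c)) *\<^sub>R (y - ?m) \<partial>M)"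
        by (simp add: inner_diff_right flip: scaleR_add_left)
      ultimately show ?thesis unfolding covariance_def
        by (subst (asm) Bochner_Integration.integral_add) (auto intro!: integrable_cont continuous_intros)
    qed
    moreover have "N = (\<integral>y. (exp (?e y) - 1) *\<^sub>R (y - ?m) \<partial>M)"
    proof -
      have "(\<integral>y. y - ?m \<partial>M) = 0" using int_y by (simp add: mean_def prob_space)
      then show ?thesis unfolding N_def scaleR_diff_left
        by (subst Bochner_Integration.integral_diff) (auto intro!: integrable_cont continuous_intros)
    qed
    ultimately have "N - covariance M h = (\<integral>y. (exp (?e y) - 1 - ?e y) *\<^sub>R (y - ?m) \<partial>M)"
      unfolding scaleR_diff_left[of _ "?e _"]
      by (subst Bochner_Integration.integral_diff) (auto intro!: integrable_cont continuous_intros)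
    also have "norm \<dots> \<le> ((norm h * R)\<^sup>2 * exp R) * (2 * R)"
    proof (intro norm_integral_le M continuous_intros)
      fix y assume y: "y \<in> cball c R"
      have "\<bar>exp (?e y) - 1 - ?e y\<bar> \<le> (?e y)\<^sup>2 * exp \<bar>?e y\<bar>" by (rule abs_exp_minus_linear_le)
      also have "\<dots> \<le> (norm h * R)\<^sup>2 * exp R"
        using e_abs[OF y] by (intro mult_mono abs_le_square_iff[THEN iffD1]) auto
      finally show "norm ((exp (?e y) - 1 - ?e y) *\<^sub>R (y - ?m)) \<le> ((norm h * R)\<^sup>2 * exp R) * (2 * R)"
        unfolding norm_scaleR using norm_diff_mean_le[OF M y] by (intro mult_mono) auto
    qed
    finally show ?thesis by (simp add: power_mult_distrib power3_eq_cube power2_eq_square mult_ac)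
  qed
  moreover have "norm ((1 - D) *\<^sub>R covariance M h) \<le> 4 * R ^ 3 * exp R * (norm h)\<^sup>2"
  proof -
    have "D - 1 = (\<integral>y. exp (?e y) - 1 \<partial>M)" unfolding D_def
      by (subst Bochner_Integration.integral_diff) (auto simp: prob_space intro!: integrable_cont continuous_intros)
    also have "norm \<dots> \<le> norm h * R * exp R"
    proof (intro norm_integral_le M continuous_intros)
      fix y assume y: "y \<in> cball c R"
      show "norm (exp (?e y) - 1) \<le> norm h * R * exp R"
        using abs_exp_minus_one_le[of "?e y"] e_abs[OF y] R_nonneg
        by (auto intro!: order_trans[OF abs_exp_minus_one_le] mult_mono)
    qed
    finally have "\<bar>1 - D\<bar> \<le> norm h * R * exp R" by simp
    then have "\<bar>1 - D\<bar> * norm (covariance M h) \<le> (norm h * R * exp R) * (4 * R\<^sup>2 * norm h)"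
      using R_nonneg by (intro mult_mono norm_covariance_le M) auto
    then show ?thesis by (simp add: power3_eq_cube power2_eq_square mult_ac)
  qed
  ultimately have bd: "norm (N - covariance M h + (1 - D) *\<^sub>R covariance M h) \<le> 6 * R ^ 3 * exp R * (norm h)\<^sup>2"
    by (intro order_trans[OF norm_triangle_ineq]) linarith
  have "mean (tilt M h) - ?m - covariance M h = (N - covariance M h + (1 - D) *\<^sub>R covariance M h) /\<^sub>R D"
    using \<open>mean (tilt M h) - ?m = N /\<^sub>R D\<close> D_pos by (simp add: algebra_simps)
  then have "norm (mean (tilt M h) - ?m - covariance M h) =
      inverse D * norm (N - covariance M h + (1 - D) *\<^sub>R covariance M h)"
    using D_pos by simp
  also have "\<dots> \<le> exp R * (6 * R ^ 3 * exp R * (norm h)\<^sup>2)"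
  proof (intro mult_mono bd)
    have "inverse D \<le> inverse (exp (- R))" using D_ge by (intro le_imp_inverse_le) auto
    then show "inverse D \<le> exp R" by (simp add: exp_minus)
  qed auto
  finally show ?thesis by (simp add: power2_eq_square mult_ac)
qed

text \<open>The first summand is the local constant for |h| <= 1. For |h| > 1 boundedness of the
  mean and of the covariance gives 2 R + 4 R^2 |h|, which is at most (2 R + 4 R^2) |h|^2.\<close>

definition mean_rem where "mean_rem = 6 * R ^ 3 * (exp R)\<^sup>2 + 2 * R + 4 * R\<^sup>2"

lemma mean_rem_nonneg: "0 \<le> mean_rem"
  using R_nonneg by (simp add: mean_rem_def)

lemma mean_tilt_remainder:
  "norm (mean (tilt M (\<theta> + h)) - mean (tilt M \<theta>) - covariance (tilt M \<theta>) h) \<le> mean_rem * (norm h)\<^sup>2"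
proof -
  interpret T: bounded_support "tilt M \<theta>" c R by (rule bounded_support_tilt)
  have T: "prob_space (tilt M \<theta>)" "prob_space (tilt M (\<theta> + h))" by (rule prob_space_tilt)+
  interpret T': bounded_support "tilt M (\<theta> + h)" c R by (rule bounded_support_tilt)
  show ?thesis
  proof (cases "norm h \<le> 1")
    case True
    have "norm (mean (tilt M (\<theta> + h)) - mean (tilt M \<theta>) - covariance (tilt M \<theta>) h)
        \<le> 6 * R ^ 3 * (exp R)\<^sup>2 * (norm h)\<^sup>2"
      using T.mean_tilt_remainder_local[OF T(1) True] by (simp add: tilt_tilt)
    also have "\<dots> \<le> mean_rem * (norm h)\<^sup>2"
      using R_nonneg by (intro mult_right_mono) (auto simp: mean_rem_def)
    finally show ?thesis .
  next
    case False
    then have h: "1 \<le> norm h" by simp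
    have "norm (mean (tilt M (\<theta> + h)) - mean (tilt M \<theta>) - covariance (tilt M \<theta>) h) \<le> 2 * R + 4 * R\<^sup>2 * norm h"
      by (intro order_trans[OF norm_triangle_ineq4] add_mono T.norm_diff_mean_le T.norm_covariance_le
          T'.mean_mem_cball T)
    also have "\<dots> \<le> 2 * R * (norm h)\<^sup>2 + 4 * R\<^sup>2 * (norm h)\<^sup>2"
      using h R_nonneg
      by (intro add_mono mult_left_mono) (auto simp: one_le_power self_le_power mult_le_cancel_left1)
    also have "\<dots> \<le> mean_rem * (norm h)\<^sup>2"
      using R_nonneg by (simp add: mean_rem_def distrib_right)
    finally show ?thesis .
  qed
qed

lemma has_derivative_mean_tilt:
  "((\<lambda>\<theta>. mean (tilt M \<theta>)) has_derivative covariance (tilt M \<theta>)) (at \<theta>)"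
proof (rule has_derivative_quadratic_remainder[OF _ mean_tilt_remainder])
  interpret T: bounded_support "tilt M \<theta>" c R by (rule bounded_support_tilt)
  show "bounded_linear (covariance (tilt M \<theta>))"
    using T.linear_covariance by (rule linear_conv_bounded_linear[THEN iffD1])
qed

text \<open>The tilted mean is the gradient of the logarithmic moment generating function, a convex
  function, hence monotone. Quantitatively, its component along \<open>h\<close> on the segment from
  \<theta> to \<theta> + h has a variance as derivative, and the mean value theorem carries both
  variance bounds over.\<close>

lemma mean_tilt_one_sided:
  shows "0 \<le> (mean (tilt M (\<theta> + h)) - mean (tilt M \<theta>)) \<bullet> h" (is ?lower)
    and "(mean (tilt M (\<theta> + h)) - mean (tilt M \<theta>)) \<bullet> h \<le> R\<^sup>2 * (norm h)\<^sup>2" (is ?upper)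
proof -
  let ?f = "\<lambda>t. mean (tilt M (\<theta> + t *\<^sub>R h)) \<bullet> h"
  have f: "(?f has_real_derivative covariance (tilt M (\<theta> + t *\<^sub>R h)) h \<bullet> h) (at t)" for t
  proof -
    interpret T: bounded_support "tilt M (\<theta> + t *\<^sub>R h)" c R by (rule bounded_support_tilt)
    have "((\<lambda>t. \<theta> + t *\<^sub>R h) has_derivative (\<lambda>s. s *\<^sub>R h)) (at t)"
      by (auto intro!: derivative_eq_intros)
    from has_derivative_compose[OF this has_derivative_mean_tilt]
    have "(?f has_derivative (\<lambda>s. covariance (tilt M (\<theta> + t *\<^sub>R h)) (s *\<^sub>R h) \<bullet> h)) (at t)"
      by (rule has_derivative_inner_left)
    then show ?thesis
      by (simp add: has_field_derivative_def linear_scale[OF T.linear_covariance] mult.commute[of _ "_ \<bullet> _"] cong: if_cong)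
  qed
  obtain t where t: "?f 1 - ?f 0 = (1 - 0) * (covariance (tilt M (\<theta> + t *\<^sub>R h)) h \<bullet> h)"
    using MVT2[of 0 1 ?f "\<lambda>t. covariance (tilt M (\<theta> + t *\<^sub>R h)) h \<bullet> h"] f by auto
  interpret T: bounded_support "tilt M (\<theta> + t *\<^sub>R h)" c R by (rule bounded_support_tilt)
  show ?lower ?upper
    using t T.covariance_inner_bounds[OF prob_space_tilt, of h] by (auto simp: inner_diff_left)
qed

end

section \<open>Gaussian densities\<close>

definition gauss :: "real \<Rightarrow> real ^ 'n \<Rightarrow> real" where
  "gauss s x = exp (- (norm x)\<^sup>2 / (2 * s\<^sup>2)) / sqrt (2 * pi * s\<^sup>2) ^ CARD('n)"

lemma gaussian_eq: "gaussian s = density lborel (\<lambda>x. ennreal (gauss s x))"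
  by (simp add: gaussian_def gauss_def)

lemma measurable_gauss [measurable]: "gauss s \<in> borel_measurable borel"
  unfolding gauss_def by measurable

lemma gauss_nonneg [simp]: "0 \<le> gauss s x"
  by (simp add: gauss_def)

lemma gauss_pos: "0 < s \<Longrightarrow> 0 < gauss s x"
  by (simp add: gauss_def)

lemma gauss_minus: "gauss s (- x) = gauss s x"
  by (simp add: gauss_def)

lemma measurable_vec_component [measurable]:
  "(\<lambda>x :: real ^ 'n. x $ i) \<in> borel_measurable borel"
  by (intro borel_measurable_continuous_onI continuous_intros)

lemma gauss_eq_prod:
  "gauss s (x - m :: real ^ 'n) = (\<Prod>b\<in>Basis. normal_density (m \<bullet> b) s (x \<bullet> b))"
proof -
  have "(norm (x - m))\<^sup>2 = (\<Sum>b\<in>Basis. (x \<bullet> b - m \<bullet> b)\<^sup>2)"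
    unfolding power2_norm_eq_inner by (subst euclidean_inner) (simp add: inner_diff_left power2_eq_square)
  then have "exp (- (norm (x - m))\<^sup>2 / (2 * s\<^sup>2)) = (\<Prod>b\<in>Basis. exp (- (x \<bullet> b - m \<bullet> b)\<^sup>2 / (2 * s\<^sup>2)))"
    by (simp add: exp_sum[symmetric] sum_negf sum_divide_distrib)
  moreover have "(\<Prod>b\<in>Basis. normal_density (m \<bullet> b) s (x \<bullet> b)) =
      (1 / sqrt (2 * pi * s\<^sup>2)) ^ CARD('n) * (\<Prod>b\<in>Basis. exp (- (x \<bullet> b - m \<bullet> b)\<^sup>2 / (2 * s\<^sup>2)))"
    by (simp only: normal_density_def prod.distrib prod_constant) simp
  ultimately show ?thesis
    by (simp only: gauss_def) (simp add: power_one_over)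
qed

lemma nn_integral_gauss:
  fixes m :: "real ^ 'n"
  assumes "0 < s"
  shows "(\<integral>\<^sup>+x. ennreal (gauss s (x - m)) \<partial>lborel) = 1"
proof -
  have "(\<integral>\<^sup>+x. ennreal (gauss s (x - m)) \<partial>lborel) =
      (\<integral>\<^sup>+x. (\<Prod>b\<in>(Basis :: (real ^ 'n) set). ennreal (normal_density (m \<bullet> b) s (x \<bullet> b))) \<partial>lborel)"
    by (simp add: gauss_eq_prod prod_ennreal)
  also have "\<dots> = (\<Prod>b\<in>(Basis :: (real ^ 'n) set). \<integral>\<^sup>+x. ennreal (normal_density (m \<bullet> b) s x) \<partial>lborel)"
    by (rule nn_integral_lborel_prod) auto
  also have "\<dots> = 1"
    using assms by (simp add: nn_integral_eq_integral)
  finally show ?thesis .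
qed

lemma prob_space_gaussian: "0 < s \<Longrightarrow> prob_space (gaussian s)"
  using nn_integral_gauss[of s 0] by (intro prob_spaceI) (simp add: gaussian_eq emeasure_density)

lemma sets_gaussian [simp, measurable_cong]: "sets (gaussian s) = sets borel"
  by (simp add: gaussian_eq)

lemma integrable_gauss_coordinate:
  fixes m :: "real ^ 'n"
  assumes "0 < s"
  shows "integrable lborel (\<lambda>x. gauss s (x - m) * ((x - m) $ i))"
proof (rule integrableI_bounded)
  \<comment> \<open>Coordinate \<open>i\<close> is carried by the factor at the basis vector
    \<open>axis i 1\<close>; every other factor has weight 1. The integral becomes a first absolute
    moment times total masses.\<close>
  let ?f = "\<lambda>b x. ennreal (normal_density (m \<bullet> b) s x * (if b = axis i 1 then \<bar>x - m \<bullet> b\<bar> else 1))"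
  have "(\<integral>\<^sup>+x. ennreal (norm (gauss s (x - m) * ((x - m) $ i))) \<partial>lborel) =
      (\<integral>\<^sup>+x. (\<Prod>b\<in>Basis. ?f b (x \<bullet> b)) \<partial>lborel)"
  proof (intro nn_integral_cong)
    fix x
    have "(\<Prod>b\<in>Basis. if b = axis i 1 then \<bar>x \<bullet> b - m \<bullet> b\<bar> else 1) = \<bar>(x - m) $ i\<bar>"
      by (simp add: prod.delta axis_in_Basis_iff inner_axis)
    then show "ennreal (norm (gauss s (x - m) * ((x - m) $ i))) = (\<Prod>b\<in>Basis. ?f b (x \<bullet> b))"
      by (subst prod_ennreal) (simp_all add: prod.distrib gauss_eq_prod[symmetric] abs_mult)
  qed
  also have "\<dots> = (\<Prod>b\<in>Basis. \<integral>\<^sup>+x. ?f b x \<partial>lborel)"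
    by (rule nn_integral_lborel_prod) auto
  also have "\<dots> = (\<Prod>b\<in>Basis. ennreal (\<integral>x. normal_density (m \<bullet> b) s x * (if b = axis i 1 then \<bar>x - m \<bullet> b\<bar> else 1) \<partial>lborel))"
  proof (intro prod.cong refl nn_integral_eq_integral)
    fix b :: "real ^ 'n"
    show "integrable lborel (\<lambda>x. normal_density (m \<bullet> b) s x * (if b = axis i 1 then \<bar>x - m \<bullet> b\<bar> else 1))"
      using integrable_normal_moment_abs[OF assms, of "m \<bullet> b" 1] integrable_normal_density[OF assms, of "m \<bullet> b"]
      by (cases "b = axis i 1") simp_all
  qed auto
  also have "\<dots> < \<infinity>"
    by (subst prod_ennreal) (auto intro!: integral_nonneg_AE)
  finally show "(\<integral>\<^sup>+x. ennreal (norm (gauss s (x - m) * ((x - m) $ i))) \<partial>lborel) < \<infinity>" .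
qed measurable

lemma integral_gauss:
  assumes "0 < s"
  shows "integrable lborel (\<lambda>x. gauss s (x - m))" "(\<integral>x. gauss s (x - m) \<partial>lborel) = 1"
proof -
  show int: "integrable lborel (\<lambda>x. gauss s (x - m))"
    using nn_integral_gauss[OF assms, of m] by (intro integrableI_nonneg) auto
  have "ennreal (\<integral>x. gauss s (x - m) \<partial>lborel) = ennreal 1"
    using nn_integral_eq_integral[OF int] nn_integral_gauss[OF assms, of m] by simp
  then show "(\<integral>x. gauss s (x - m) \<partial>lborel) = 1"
    by (subst (asm) ennreal_inj) (auto intro!: integral_nonneg_AE)
qed

text \<open>The reflection of x to 2 m - x preserves Lebesgue measure and changes the sign of the
  centred integrand, so the centred moment vanishes. The shift \<open>k\<close> leaves room for
  subtracting a conditional mean.\<close>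

lemma integral_gauss_coordinate:
  assumes "0 < s"
  shows "(\<integral>x. gauss s (x - m) * (x $ i - k) \<partial>lborel) = m $ i - k"
proof -
  let ?f = "\<lambda>x. gauss s (x - m) * ((x - m) $ i)"
  note int = integrable_gauss_coordinate[OF assms, of m i]
  have "(\<integral>x. ?f x \<partial>lborel) = (\<integral>x. ?f x \<partial>distr lborel borel (\<lambda>x. 2 *\<^sub>R m + (-1) *\<^sub>R x))"
    using lborel_affine[of "-1" "2 *\<^sub>R m"] by (simp add: density_1)
  also have "\<dots> = (\<integral>x. ?f (2 *\<^sub>R m + (-1) *\<^sub>R x) \<partial>lborel)"
    by (rule integral_distr) measurable
  also have "\<dots> = (\<integral>x. - ?f x \<partial>lborel)"
  proof (intro Bochner_Integration.integral_cong refl)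
    fix x
    have "2 *\<^sub>R m + (-1) *\<^sub>R x - m = - (x - m)" by (simp add: scaleR_2)
    then show "?f (2 *\<^sub>R m + (-1) *\<^sub>R x) = - ?f x" by (simp only: gauss_minus vector_uminus_component mult_minus_right)
  qed
  finally have 0: "(\<integral>x. ?f x \<partial>lborel) = 0" by simp
  have "(\<integral>x. gauss s (x - m) * (x $ i - k) \<partial>lborel) = (\<integral>x. ?f x + gauss s (x - m) * (m $ i - k) \<partial>lborel)"
    by (intro Bochner_Integration.integral_cong) (auto simp: algebra_simps)
  also have "\<dots> = m $ i - k"
    using int integral_gauss[OF assms, of m] 0 by simp
  finally show ?thesis .
qed

text \<open>Substitution x = t + b w. The Jacobian b^n is exactly the ratio of the normalising
  constants, so only the standard deviation is rescaled.\<close>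

lemma nn_integral_gauss_affine:
  fixes t :: "real ^ 'n"
  assumes b: "0 < b" and s: "0 < s" and [measurable]: "H \<in> borel_measurable borel"
  shows "(\<integral>\<^sup>+w. ennreal (gauss s w) * H (t + b *\<^sub>R w) \<partial>lborel) =
    (\<integral>\<^sup>+x. ennreal (gauss (b * s) (x - t)) * H x \<partial>lborel)"
proof -
  have scale: "b ^ CARD('n) * gauss (b * s) (b *\<^sub>R w) = gauss s w" for w :: "real ^ 'n"
    using b by (simp add: gauss_def power_mult_distrib real_sqrt_mult field_simps)
  have "(\<integral>\<^sup>+x. ennreal (gauss (b * s) (x - t)) * H x \<partial>lborel) =
      (\<integral>\<^sup>+x. ennreal (gauss (b * s) (x - t)) * H x
        \<partial>density (distr lborel borel (\<lambda>x. t + b *\<^sub>R x)) (\<lambda>_. ennreal (\<bar>b\<bar> ^ CARD('n))))"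
    using lborel_affine[of b t] b by simp
  also have "\<dots> = (\<integral>\<^sup>+w. ennreal (\<bar>b\<bar> ^ CARD('n)) * (ennreal (gauss (b * s) (b *\<^sub>R w)) * H (t + b *\<^sub>R w)) \<partial>lborel)"
    by (simp add: nn_integral_density nn_integral_distr)
  also have "\<dots> = (\<integral>\<^sup>+w. ennreal (gauss s w) * H (t + b *\<^sub>R w) \<partial>lborel)"
    using b by (intro nn_integral_cong) (simp add: scale[symmetric] ennreal_mult mult.assoc)
  finally show ?thesis ..
qed

text \<open>Completing the square in \<open>z\<close>: this is the conditional law of \<open>Z\<close> given \<open>a Z + b \<sigma> W = x\<close>.\<close>

lemma gauss_mult_gauss:
  fixes x z :: "real ^ 'n"
  assumes b: "0 < b" and \<sigma>: "0 < \<sigma>" and A: "A = a\<^sup>2 + \<sigma>\<^sup>2 * b\<^sup>2"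
  shows "gauss 1 z * gauss (b * \<sigma>) (x - a *\<^sub>R z) =
    gauss (sqrt A) x * gauss (b * \<sigma> / sqrt A) (z - (a / A) *\<^sub>R x)"
proof -
  have A_pos: "0 < A" using b \<sigma> by (simp add: A add_nonneg_pos)
  have "(norm z)\<^sup>2 / 2 + (norm (x - a *\<^sub>R z))\<^sup>2 / (2 * (b * \<sigma>)\<^sup>2) =
      (norm x)\<^sup>2 / (2 * A) + (norm (z - (a / A) *\<^sub>R x))\<^sup>2 / (2 * ((b * \<sigma>)\<^sup>2 / A))"
  proof -
    define P where "P = (norm z)\<^sup>2"
    define Q where "Q = (norm x)\<^sup>2"
    define S where "S = x \<bullet> z"
    define k where "k = (b * \<sigma>)\<^sup>2"
    have k: "0 < k" "A = a\<^sup>2 + k" using b \<sigma> by (auto simp: k_def A power_mult_distrib mult.commute)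
    have 1: "(norm (x - a *\<^sub>R z))\<^sup>2 = Q - 2 * a * S + a\<^sup>2 * P"
      unfolding P_def Q_def S_def power2_norm_eq_inner
      by (simp add: inner_diff_left inner_diff_right inner_commute power2_eq_square algebra_simps)
    have 2: "(norm (z - (a / A) *\<^sub>R x))\<^sup>2 = P - 2 * (a / A) * S + (a / A)\<^sup>2 * Q"
      unfolding P_def Q_def S_def power2_norm_eq_inner
      by (simp add: inner_diff_left inner_diff_right inner_commute power2_eq_square algebra_simps)
    have "P / 2 + (Q - 2 * a * S + a\<^sup>2 * P) / (2 * k) = Q / (2 * A) + (P - 2 * (a / A) * S + (a / A)\<^sup>2 * Q) / (2 * (k / A))"
    proof -
      have "Q / (2 * A) + (P - 2 * (a / A) * S + (a / A)\<^sup>2 * Q) / (2 * (k / A)) =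
          (A * P - 2 * a * S + (k + a\<^sup>2) / A * Q) / (2 * k)"
        using k(1) A_pos by (simp add: divide_simps power2_eq_square) (simp add: algebra_simps)
      also have "(k + a\<^sup>2) / A = 1" using k A_pos by simp
      also have "A * P = k * P + a\<^sup>2 * P" using k by (simp add: algebra_simps)
      finally show ?thesis using k by (simp add: field_simps)
    qed
    then show ?thesis unfolding 1 2 P_def[symmetric] Q_def[symmetric] k_def[symmetric] .
  qed
  then have e: "exp (- (norm z)\<^sup>2 / 2) * exp (- (norm (x - a *\<^sub>R z))\<^sup>2 / (2 * (b * \<sigma>)\<^sup>2)) =
      exp (- (norm x)\<^sup>2 / (2 * A)) * exp (- (norm (z - (a / A) *\<^sub>R x))\<^sup>2 / (2 * ((b * \<sigma>)\<^sup>2 / A)))"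
    unfolding exp_add[symmetric] by (simp add: algebra_simps)
  \<comment> \<open>The normalising constants agree because the variances have the same product: 1
    times (b \<sigma>)^2 equals A times (b \<sigma>)^2 / A.\<close>
  have c: "sqrt (2 * pi * 1\<^sup>2) * sqrt (2 * pi * (b * \<sigma>)\<^sup>2) = sqrt (2 * pi * A) * sqrt (2 * pi * ((b * \<sigma>)\<^sup>2 / A))"
    using A_pos by (simp flip: real_sqrt_mult)
  have q: "(sqrt A)\<^sup>2 = A" "(b * \<sigma> / sqrt A)\<^sup>2 = (b * \<sigma>)\<^sup>2 / A"
    using A_pos by (auto simp: power_divide)
  show ?thesis
    unfolding gauss_def q
    using e arg_cong[OF c, of "\<lambda>u. u ^ CARD('n)"]
    by (simp only: times_divide_times_eq power_mult_distrib[symmetric]) (simp add: power_mult_distrib)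
qed

section \<open>Conditioning on the interpolant\<close>

text \<open>A countable basis makes this work: every point outside the support lies in a null basic
  open set, and countably many of these have a null union.\<close>

lemma supp_AE:
  fixes \<rho> :: "'a::second_countable_topology measure"
  assumes sets: "sets \<rho> = sets borel"
  shows "AE y in \<rho>. y \<in> supp \<rho>"
proof -
  obtain \<B> :: "'a set set" where \<B>: "countable \<B>" "topological_basis \<B>"
    using ex_countable_basis by auto
  let ?N = "\<Union>U\<in>{U \<in> \<B>. emeasure \<rho> U = 0}. U"
  have "?N \<in> null_sets \<rho>"
  proof (rule null_sets_UN')
    show "countable {U \<in> \<B>. emeasure \<rho> U = 0}" using \<B>(1) by simp
    show "U \<in> null_sets \<rho>" if "U \<in> {U \<in> \<B>. emeasure \<rho> U = 0}" for U
      using that topological_basis_open[OF \<B>(2)] sets by (auto simp: null_sets_def)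
  qed
  moreover have "y \<in> ?N" if "y \<notin> supp \<rho>" for y
  proof -
    have "\<exists>U. open U \<and> y \<in> U \<and> emeasure \<rho> U = 0"
      using that unfolding supp_def by (simp add: zero_less_iff_neq_zero)
    then obtain U where U: "open U" "y \<in> U" "emeasure \<rho> U = 0" by blast
    obtain V where V: "V \<in> \<B>" "y \<in> V" "V \<subseteq> U"
      using topological_basisE[OF \<B>(2) U(1,2)] by blast
    have "emeasure \<rho> V \<le> emeasure \<rho> U"
      using V U sets by (intro emeasure_mono) auto
    then show ?thesis using U V by auto
  qed
  ultimately show ?thesis
    by (intro AE_I'[of ?N]) auto
qed

section \<open>Posterior of the compactly supported component\<close>

locale gaussian_convolution = bounded_support \<rho> c R + prob_space \<rho>
  for \<rho> :: "(real ^ 'n) measure" and c R +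
  fixes \<sigma> :: real
  assumes \<sigma>_pos: "0 < \<sigma>"
begin

text \<open>Given the value y of the compactly supported component, a Z + b X1 is Gaussian with mean
  b y and variance a^2 + \<sigma>^2 b^2. The weight is the factor of this likelihood that involves y
  but not the observed value x; the mixed factor is the exponential of a linear function of y, so x
  enters only as a tilt parameter.\<close>

definition posterior_base :: "real \<Rightarrow> real \<Rightarrow> (real ^ 'n) measure" where
  "posterior_base a b = density \<rho> (\<lambda>y. ennreal (exp (- (b\<^sup>2 * (norm y)\<^sup>2) / (2 * (a\<^sup>2 + \<sigma>\<^sup>2 * b\<^sup>2)))))"

text \<open>The conditional expectation of the \<open>\<rho>\<close>-component of \<open>X1\<close> given \<open>a Z + b X1 = x\<close>.\<close>

definition posterior_mean :: "real \<Rightarrow> real \<Rightarrow> real ^ 'n \<Rightarrow> real ^ 'n" where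
  "posterior_mean a b x = mean (tilt (posterior_base a b) ((b / (a\<^sup>2 + \<sigma>\<^sup>2 * b\<^sup>2)) *\<^sub>R x))"

lemma bounded_support_posterior_base: "bounded_support (posterior_base a b) c R"
proof -
  let ?w = "\<lambda>y. exp (- (b\<^sup>2 * (norm y)\<^sup>2) / (2 * (a\<^sup>2 + \<sigma>\<^sup>2 * b\<^sup>2)))"
  have "(\<integral>\<^sup>+y. ennreal (?w y) \<partial>\<rho>) \<le> (\<integral>\<^sup>+y. 1 \<partial>\<rho>)"
    by (intro nn_integral_mono) (simp add: ennreal_le_1 zero_le_divide_iff)
  then have "(\<integral>\<^sup>+y. ennreal (?w y) \<partial>\<rho>) \<le> 1"
    by (simp add: emeasure_space_1)
  then have "emeasure (posterior_base a b) (space (posterior_base a b)) \<noteq> \<infinity>"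
    by (auto simp: posterior_base_def emeasure_density space_eq top_unique)
  then interpret P: finite_measure "posterior_base a b" by (rule finite_measureI)
  show ?thesis
  proof
    show "sets (posterior_base a b) = sets borel"
      by (simp add: posterior_base_def)
    show "AE y in posterior_base a b. y \<in> cball c R"
      unfolding posterior_base_def by (subst AE_density) (use AE_cball in \<open>auto elim: AE_mp\<close>)
    show "emeasure (posterior_base a b) (space (posterior_base a b)) \<noteq> 0"
      by (simp add: posterior_base_def emeasure_density space_eq nn_integral_0_iff_AE)
  qed
qed

lemma gauss_minus_scale:
  assumes "A = a\<^sup>2 + \<sigma>\<^sup>2 * b\<^sup>2" "0 < A"
  shows "gauss (sqrt A) (x - b *\<^sub>R y) = gauss (sqrt A) x *
    (exp (- (b\<^sup>2 * (norm y)\<^sup>2) / (2 * A)) * exp (((b / A) *\<^sub>R x) \<bullet> y))"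
proof -
  have n: "(norm (x - b *\<^sub>R y))\<^sup>2 = (norm x)\<^sup>2 - 2 * b * (x \<bullet> y) + b\<^sup>2 * (norm y)\<^sup>2"
    unfolding power2_norm_eq_inner
    by (simp add: inner_diff_left inner_diff_right inner_commute power2_eq_square algebra_simps)
  have "- (norm (x - b *\<^sub>R y))\<^sup>2 / (2 * A) =
      - (norm x)\<^sup>2 / (2 * A) + (- (b\<^sup>2 * (norm y)\<^sup>2) / (2 * A) + ((b / A) *\<^sub>R x) \<bullet> y)"
    unfolding n using assms(2) by (simp add: field_simps)
  then have "exp (- (norm (x - b *\<^sub>R y))\<^sup>2 / (2 * A)) =
      exp (- (norm x)\<^sup>2 / (2 * A)) * (exp (- (b\<^sup>2 * (norm y)\<^sup>2) / (2 * A)) * exp (((b / A) *\<^sub>R x) \<bullet> y))"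
    by (simp only: exp_add)
  then show ?thesis
    using assms(2) by (simp add: gauss_def)
qed

text \<open>Bayes' formula for the posterior mean with the denominator cleared, which is the form in
  which the residual is integrated later.\<close>

lemma integral_posterior_mean:
  assumes A: "A = a\<^sup>2 + \<sigma>\<^sup>2 * b\<^sup>2" "0 < A"
  shows "(\<integral>y. gauss (sqrt A) (x - b *\<^sub>R y) *\<^sub>R (y - posterior_mean a b x) \<partial>\<rho>) = 0"
proof -
  interpret P: bounded_support "posterior_base a b" c R by (rule bounded_support_posterior_base)
  let ?\<theta> = "(b / A) *\<^sub>R x" and ?m = "posterior_mean a b x"
  have m: "?m = (\<integral>y. exp (?\<theta> \<bullet> y) *\<^sub>R y \<partial>posterior_base a b) /\<^sub>R (\<integral>y. exp (?\<theta> \<bullet> y) \<partial>posterior_base a b)"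
    unfolding posterior_mean_def A(1)[symmetric] mean_def by (rule P.integral_tilt) simp
  have "(\<integral>y. gauss (sqrt A) (x - b *\<^sub>R y) *\<^sub>R (y - ?m) \<partial>\<rho>) =
     (\<integral>y. gauss (sqrt A) x *\<^sub>R (exp (- (b\<^sup>2 * (norm y)\<^sup>2) / (2 * A)) *\<^sub>R (exp (?\<theta> \<bullet> y) *\<^sub>R (y - ?m))) \<partial>\<rho>)"
    unfolding gauss_minus_scale[OF A] by simp
  also have "\<dots> = gauss (sqrt A) x *\<^sub>R (\<integral>y. exp (- (b\<^sup>2 * (norm y)\<^sup>2) / (2 * A)) *\<^sub>R (exp (?\<theta> \<bullet> y) *\<^sub>R (y - ?m)) \<partial>\<rho>)"
    by (rule integral_scaleR_right)
  also have "(\<integral>y. exp (- (b\<^sup>2 * (norm y)\<^sup>2) / (2 * A)) *\<^sub>R (exp (?\<theta> \<bullet> y) *\<^sub>R (y - ?m)) \<partial>\<rho>) =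
      (\<integral>y. exp (?\<theta> \<bullet> y) *\<^sub>R (y - ?m) \<partial>posterior_base a b)"
    unfolding posterior_base_def A(1)[symmetric] by (rule integral_density[symmetric]) auto
  also have "\<dots> = (\<integral>y. exp (?\<theta> \<bullet> y) *\<^sub>R y \<partial>posterior_base a b) - (\<integral>y. exp (?\<theta> \<bullet> y) *\<^sub>R ?m \<partial>posterior_base a b)"
    unfolding scaleR_diff_right
    by (intro Bochner_Integration.integral_diff P.integrable_cont continuous_intros)
  also have "(\<integral>y. exp (?\<theta> \<bullet> y) *\<^sub>R ?m \<partial>posterior_base a b) = (\<integral>y. exp (?\<theta> \<bullet> y) \<partial>posterior_base a b) *\<^sub>R ?m"
    by (intro integral_scaleR_left P.integrable_cont continuous_intros)
  also have "\<dots> = (\<integral>y. exp (?\<theta> \<bullet> y) *\<^sub>R y \<partial>posterior_base a b)"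
    unfolding m using P.integral_exp_pos[of ?\<theta>] by simp
  finally show ?thesis by simp
qed

lemma posterior_mean_mem_cball: "posterior_mean a b x \<in> cball c R"
proof -
  interpret P: bounded_support "posterior_base a b" c R by (rule bounded_support_posterior_base)
  interpret T: bounded_support "tilt (posterior_base a b) ((b / (a\<^sup>2 + \<sigma>\<^sup>2 * b\<^sup>2)) *\<^sub>R x)" c R
    by (rule P.bounded_support_tilt)
  show ?thesis
    unfolding posterior_mean_def by (rule T.mean_mem_cball[OF P.prob_space_tilt])
qed

lemma continuous_posterior_mean: "continuous_on UNIV (posterior_mean a b)"
proof -
  interpret P: bounded_support "posterior_base a b" c R by (rule bounded_support_posterior_base)
  have cont: "continuous_on UNIV (\<lambda>\<theta>. mean (tilt (posterior_base a b) \<theta>))"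
    by (intro continuous_at_imp_continuous_on ballI has_derivative_continuous[OF P.has_derivative_mean_tilt])
  show ?thesis
    unfolding posterior_mean_def[abs_def]
    by (rule continuous_on_compose2[OF cont, of UNIV]) (auto intro!: continuous_intros)
qed

text \<open>The joint law of the interpolant and \<open>Z\<close>, disintegrated in the order
  interpolant, compact component, \<open>Z\<close>. Nonnegative integrands make all interchanges
  free of integrability conditions; signed integrands are treated through the resulting equality of
  measures.\<close>

lemma nn_integral_interpolant:
  fixes M :: "'w measure" and Z X1 :: "'w \<Rightarrow> real ^ 'n"
  assumes M: "prob_space M"
    and [measurable]: "Z \<in> borel_measurable M" "X1 \<in> borel_measurable M"
    and Z: "distr M borel Z = gaussian 1" and X1: "distr M borel X1 = (gaussian \<sigma> \<star> \<rho>)"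
    and indep: "prob_space.indep_var M borel Z borel X1"
    and b: "0 < b" and A: "A = a\<^sup>2 + \<sigma>\<^sup>2 * b\<^sup>2"
    and F [measurable]: "F \<in> borel_measurable (borel \<Otimes>\<^sub>M borel)"
  shows "(\<integral>\<^sup>+\<omega>. F (a *\<^sub>R Z \<omega> + b *\<^sub>R X1 \<omega>, Z \<omega>) \<partial>M) =
    (\<integral>\<^sup>+x. \<integral>\<^sup>+y. \<integral>\<^sup>+z. ennreal (gauss (sqrt A) (x - b *\<^sub>R y) *
        gauss (b * \<sigma> / sqrt A) (z - (a / A) *\<^sub>R (x - b *\<^sub>R y))) * F (x, z) \<partial>lborel \<partial>\<rho> \<partial>lborel)"
proof -
  interpret M: prob_space M by (rule M)
  interpret G1: prob_space "gaussian 1 :: (real ^ 'n) measure" by (rule prob_space_gaussian) simp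
  interpret G: prob_space "gaussian \<sigma> :: (real ^ 'n) measure" by (rule prob_space_gaussian) (rule \<sigma>_pos)
  have "prob_space (gaussian \<sigma> \<star> \<rho>)"
    unfolding X1[symmetric] by (rule M.prob_space_distr) simp
  then interpret N: prob_space "gaussian \<sigma> \<star> \<rho>" .
  have [measurable_cong]: "sets (gaussian \<sigma> \<star> \<rho>) = sets borel" by simp
  interpret LR: pair_sigma_finite lborel \<rho> ..
  interpret RL: pair_sigma_finite \<rho> lborel ..
  interpret GR: pair_sigma_finite "gaussian \<sigma> :: (real ^ 'n) measure" \<rho> ..
  let ?D = "\<lambda>x y z. ennreal (gauss (sqrt A) (x - b *\<^sub>R y) * gauss (b * \<sigma> / sqrt A) (z - (a / A) *\<^sub>R (x - b *\<^sub>R y))) * F (x, z)"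
  have joint: "distr M (borel \<Otimes>\<^sub>M borel) (\<lambda>\<omega>. (Z \<omega>, X1 \<omega>)) = gaussian 1 \<Otimes>\<^sub>M (gaussian \<sigma> \<star> \<rho>)"
    using indep unfolding M.indep_var_distribution_eq Z X1 by simp
  have "(\<integral>\<^sup>+\<omega>. F (a *\<^sub>R Z \<omega> + b *\<^sub>R X1 \<omega>, Z \<omega>) \<partial>M) =
      (\<integral>\<^sup>+p. F (a *\<^sub>R fst p + b *\<^sub>R snd p, fst p) \<partial>distr M (borel \<Otimes>\<^sub>M borel) (\<lambda>\<omega>. (Z \<omega>, X1 \<omega>)))"
    by (subst nn_integral_distr) simp_all
  also have "\<dots> = (\<integral>\<^sup>+z. \<integral>\<^sup>+x1. F (a *\<^sub>R z + b *\<^sub>R x1, z) \<partial>(gaussian \<sigma> \<star> \<rho>) \<partial>gaussian 1)"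
    unfolding joint by (subst N.nn_integral_fst[symmetric]) simp_all
  also have "\<dots> = (\<integral>\<^sup>+z. \<integral>\<^sup>+w. \<integral>\<^sup>+y. F (a *\<^sub>R z + b *\<^sub>R (w + y), z) \<partial>\<rho> \<partial>gaussian \<sigma> \<partial>gaussian 1)"
    by (intro nn_integral_cong nn_integral_convolution)
       (auto intro: G.finite_measure_axioms finite_measure_axioms)
  \<comment> \<open>The Gaussian component \<open>w\<close> of X1 is moved innermost, where the
    substitution x = a z + b y + b w replaces it by the value of the interpolant.\<close>
  also have "\<dots> = (\<integral>\<^sup>+z. \<integral>\<^sup>+y. \<integral>\<^sup>+w. F (a *\<^sub>R z + b *\<^sub>R (w + y), z) \<partial>gaussian \<sigma> \<partial>\<rho> \<partial>gaussian 1)"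
    by (intro nn_integral_cong GR.Fubini'[symmetric]) simp
  also have "\<dots> = (\<integral>\<^sup>+z. \<integral>\<^sup>+y. \<integral>\<^sup>+x. ennreal (gauss (b * \<sigma>) (x - (a *\<^sub>R z + b *\<^sub>R y))) * F (x, z) \<partial>lborel \<partial>\<rho> \<partial>gaussian 1)"
  proof (intro nn_integral_cong)
    fix z y :: "real ^ 'n"
    have "(\<integral>\<^sup>+w. F (a *\<^sub>R z + b *\<^sub>R (w + y), z) \<partial>gaussian \<sigma>) =
        (\<integral>\<^sup>+w. ennreal (gauss \<sigma> w) * F ((a *\<^sub>R z + b *\<^sub>R y) + b *\<^sub>R w, z) \<partial>lborel)"
      unfolding gaussian_eq by (subst nn_integral_density) (simp_all add: algebra_simps)
    also have "\<dots> = (\<integral>\<^sup>+x. ennreal (gauss (b * \<sigma>) (x - (a *\<^sub>R z + b *\<^sub>R y))) * F (x, z) \<partial>lborel)"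
      by (rule nn_integral_gauss_affine[OF b \<sigma>_pos, of "\<lambda>x. F (x, z)"]) simp
    finally show "(\<integral>\<^sup>+w. F (a *\<^sub>R z + b *\<^sub>R (w + y), z) \<partial>gaussian \<sigma>) =
        (\<integral>\<^sup>+x. ennreal (gauss (b * \<sigma>) (x - (a *\<^sub>R z + b *\<^sub>R y))) * F (x, z) \<partial>lborel)" .
  qed
  also have "\<dots> = (\<integral>\<^sup>+z. ennreal (gauss 1 z) * (\<integral>\<^sup>+y. \<integral>\<^sup>+x. ennreal (gauss (b * \<sigma>) (x - (a *\<^sub>R z + b *\<^sub>R y))) * F (x, z) \<partial>lborel \<partial>\<rho>) \<partial>lborel)"
    unfolding gaussian_eq by (rule nn_integral_density) measurable
  also have "\<dots> = (\<integral>\<^sup>+z. \<integral>\<^sup>+y. \<integral>\<^sup>+x. ?D x y z \<partial>lborel \<partial>\<rho> \<partial>lborel)"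
  proof (intro nn_integral_cong)
    fix z :: "real ^ 'n"
    let ?g = "\<lambda>x y. ennreal (gauss (b * \<sigma>) (x - (a *\<^sub>R z + b *\<^sub>R y))) * F (x, z)"
    have D: "ennreal (gauss 1 z) * ?g x y = ?D x y z" for x y
    proof -
      \<comment> \<open>The square is completed with x - b y, the interpolant without its compact
        component, in the role of x.\<close>
      have "x - (a *\<^sub>R z + b *\<^sub>R y) = (x - b *\<^sub>R y) - a *\<^sub>R z" by simp
      then show ?thesis
        by (simp only: gauss_mult_gauss[OF b \<sigma>_pos A, symmetric] ennreal_mult[OF gauss_nonneg gauss_nonneg] mult.assoc)
    qed
    have "ennreal (gauss 1 z) * (\<integral>\<^sup>+y. \<integral>\<^sup>+x. ?g x y \<partial>lborel \<partial>\<rho>) = (\<integral>\<^sup>+y. ennreal (gauss 1 z) * (\<integral>\<^sup>+x. ?g x y \<partial>lborel) \<partial>\<rho>)"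
      by (rule nn_integral_cmult[symmetric]) measurable
    also have "\<dots> = (\<integral>\<^sup>+y. \<integral>\<^sup>+x. ennreal (gauss 1 z) * ?g x y \<partial>lborel \<partial>\<rho>)"
      by (intro nn_integral_cong nn_integral_cmult[symmetric]) measurable
    finally show "ennreal (gauss 1 z) * (\<integral>\<^sup>+y. \<integral>\<^sup>+x. ?g x y \<partial>lborel \<partial>\<rho>) =
        (\<integral>\<^sup>+y. \<integral>\<^sup>+x. ?D x y z \<partial>lborel \<partial>\<rho>)"
      unfolding D .
  qed
  also have "\<dots> = (\<integral>\<^sup>+z. \<integral>\<^sup>+x. \<integral>\<^sup>+y. ?D x y z \<partial>\<rho> \<partial>lborel \<partial>lborel)"
    by (intro nn_integral_cong LR.Fubini') measurable
  also have "\<dots> = (\<integral>\<^sup>+x. \<integral>\<^sup>+z. \<integral>\<^sup>+y. ?D x y z \<partial>\<rho> \<partial>lborel \<partial>lborel)"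
    by (rule lborel_pair.Fubini') measurable
  also have "\<dots> = (\<integral>\<^sup>+x. \<integral>\<^sup>+y. \<integral>\<^sup>+z. ?D x y z \<partial>lborel \<partial>\<rho> \<partial>lborel)"
    by (intro nn_integral_cong RL.Fubini') measurable
  finally show ?thesis .
qed


text \<open>Integrating out z leaves a strictly positive Lebesgue density for the interpolant, and a
  nonempty open set is not Lebesgue null. The purpose is to upgrade almost sure equality of
  continuous functions of the interpolant to equality everywhere.\<close>

lemma interpolant_full_support:
  fixes M :: "'w measure" and Z X1 :: "'w \<Rightarrow> real ^ 'n"
  assumes M: "prob_space M"
    and [measurable]: "Z \<in> borel_measurable M" "X1 \<in> borel_measurable M"
    and laws: "distr M borel Z = gaussian 1" "distr M borel X1 = (gaussian \<sigma> \<star> \<rho>)"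
    and indep: "prob_space.indep_var M borel Z borel X1"
    and b: "0 < b" and U: "open U" and AE: "AE \<omega> in M. a *\<^sub>R Z \<omega> + b *\<^sub>R X1 \<omega> \<notin> U"
  shows "U = {}"
proof -
  define A where "A = a\<^sup>2 + \<sigma>\<^sup>2 * b\<^sup>2"
  have A_pos: "0 < A" using b \<sigma>_pos by (simp add: A_def add_nonneg_pos)
  define s where "s = b * \<sigma> / sqrt A"
  have s_pos: "0 < s" using b \<sigma>_pos A_pos by (simp add: s_def)
  have [measurable]: "U \<in> sets borel" using U by simp
  have "0 = (\<integral>\<^sup>+\<omega>. indicator U (a *\<^sub>R Z \<omega> + b *\<^sub>R X1 \<omega>) \<partial>M)"
    using AE by (subst nn_integral_0_iff_AE[THEN iffD2]) (auto elim!: AE_mp)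
  also have "\<dots> = (\<integral>\<^sup>+x. \<integral>\<^sup>+y. \<integral>\<^sup>+z. ennreal (gauss (sqrt A) (x - b *\<^sub>R y) *
        gauss s (z - (a / A) *\<^sub>R (x - b *\<^sub>R y))) * indicator U x \<partial>lborel \<partial>\<rho> \<partial>lborel)"
    using nn_integral_interpolant[OF M assms(2,3) laws indep b A_def, of "\<lambda>p. indicator U (fst p)"]
    by (simp add: s_def)
  also have "\<dots> = (\<integral>\<^sup>+x. \<integral>\<^sup>+y. ennreal (gauss (sqrt A) (x - b *\<^sub>R y)) * indicator U x \<partial>\<rho> \<partial>lborel)"
  proof (intro nn_integral_cong)
    fix x y
    have "(\<integral>\<^sup>+z. ennreal (gauss (sqrt A) (x - b *\<^sub>R y) * gauss s (z - (a / A) *\<^sub>R (x - b *\<^sub>R y))) * indicator U x \<partial>lborel)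
        = (\<integral>\<^sup>+z. (ennreal (gauss (sqrt A) (x - b *\<^sub>R y)) * indicator U x) *
            ennreal (gauss s (z - (a / A) *\<^sub>R (x - b *\<^sub>R y))) \<partial>lborel)"
      by (intro nn_integral_cong) (simp add: ennreal_mult mult_ac)
    also have "\<dots> = ennreal (gauss (sqrt A) (x - b *\<^sub>R y)) * indicator U x"
      by (subst nn_integral_cmult) (simp_all add: nn_integral_gauss[OF s_pos])
    finally show "(\<integral>\<^sup>+z. ennreal (gauss (sqrt A) (x - b *\<^sub>R y) * gauss s (z - (a / A) *\<^sub>R (x - b *\<^sub>R y))) * indicator U x \<partial>lborel)
        = ennreal (gauss (sqrt A) (x - b *\<^sub>R y)) * indicator U x" .
  qed
  finally have "AE x in lborel. (\<integral>\<^sup>+y. ennreal (gauss (sqrt A) (x - b *\<^sub>R y)) * indicator U x \<partial>\<rho>) = 0"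
    by (subst nn_integral_0_iff_AE[symmetric]) simp_all
  then have "AE x in lborel. x \<notin> U"
  proof eventually_elim
    fix x assume "(\<integral>\<^sup>+y. ennreal (gauss (sqrt A) (x - b *\<^sub>R y)) * indicator U x \<partial>\<rho>) = 0"
    then have "AE y in \<rho>. ennreal (gauss (sqrt A) (x - b *\<^sub>R y)) * indicator U x = 0"
      by (subst (asm) nn_integral_0_iff_AE) simp_all
    moreover have "gauss (sqrt A) u \<noteq> 0" for u :: "real ^ 'n"
      using gauss_pos[of "sqrt A" u] A_pos by simp
    ultimately have "AE y in \<rho>. x \<notin> U"
      by (simp add: indicator_def split: if_splits)
    then show "x \<notin> U" using prob_space by (simp add: AE_const)
  qed
  then have "emeasure lborel U = 0"
    by (subst (asm) AE_iff_measurable[where N = U]) auto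
  then have "negligible U"
    by (simp add: negligible_iff_null_sets null_sets_def emeasure_completion)
  with U show "U = {}" using open_not_negligible by blast
qed

text \<open>For fixed x the subtracted term is the conditional mean of \<open>Z\<close>. Integrating
  in z replaces z by (a/A)(x - b y), so the difference collapses to -(a b/A) times y minus the
  posterior mean, whose integral against the likelihood vanishes.\<close>

lemma integral_residual_eq_0:
  assumes b: "0 < b" and A: "A = a\<^sup>2 + \<sigma>\<^sup>2 * b\<^sup>2"
  shows "(\<integral>(y, z). (gauss (sqrt A) (x - b *\<^sub>R y) * gauss (b * \<sigma> / sqrt A) (z - (a / A) *\<^sub>R (x - b *\<^sub>R y))) *
      (z $ i - ((a / A) *\<^sub>R (x - b *\<^sub>R posterior_mean a b x)) $ i) \<partial>(\<rho> \<Otimes>\<^sub>M lborel)) = 0"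
    (is "integral\<^sup>L _ ?f = 0")
\<comment> \<open>The Bochner integral of a non-integrable function is 0 by convention, so only the
  integrable case needs Fubini's theorem.\<close>
proof (cases "integrable (\<rho> \<Otimes>\<^sub>M lborel) ?f")
  case True
  interpret RL: pair_sigma_finite \<rho> lborel ..
  have A_pos: "0 < A" using b \<sigma>_pos by (simp add: A add_nonneg_pos)
  have s_pos: "0 < b * \<sigma> / sqrt A" using b \<sigma>_pos A_pos by simp
  let ?m = "posterior_mean a b x"
  have "integral\<^sup>L (\<rho> \<Otimes>\<^sub>M lborel) ?f = (\<integral>y. \<integral>z. ?f (y, z) \<partial>lborel \<partial>\<rho>)"
    by (rule RL.integral_fst'[symmetric]) (rule True)
  also have "\<dots> = (\<integral>y. (gauss (sqrt A) (x - b *\<^sub>R y) *\<^sub>R (y - ?m)) $ i * (- (a * b / A)) \<partial>\<rho>)"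
  proof (intro Bochner_Integration.integral_cong refl)
    fix y
    have "(\<integral>z. ?f (y, z) \<partial>lborel) = gauss (sqrt A) (x - b *\<^sub>R y) *
       (\<integral>z. gauss (b * \<sigma> / sqrt A) (z - (a / A) *\<^sub>R (x - b *\<^sub>R y)) * (z $ i - ((a / A) *\<^sub>R (x - b *\<^sub>R ?m)) $ i) \<partial>lborel)"
      by (simp only: prod.case mult.assoc integral_mult_right_zero)
    also have "\<dots> = (gauss (sqrt A) (x - b *\<^sub>R y) *\<^sub>R (y - ?m)) $ i * (- (a * b / A))"
      unfolding integral_gauss_coordinate[OF s_pos] using less_imp_neq[OF A_pos, symmetric] by (simp add: field_simps)
    finally show "(\<integral>z. ?f (y, z) \<partial>lborel) = \<dots>" .
  qed
  also have "\<dots> = (\<integral>y. (gauss (sqrt A) (x - b *\<^sub>R y) *\<^sub>R (y - ?m)) $ i \<partial>\<rho>) * (- (a * b / A))"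
    by (rule integral_mult_left_zero)
  also have "(\<integral>y. (gauss (sqrt A) (x - b *\<^sub>R y) *\<^sub>R (y - ?m)) $ i \<partial>\<rho>) =
      (\<integral>y. gauss (sqrt A) (x - b *\<^sub>R y) *\<^sub>R (y - ?m) \<partial>\<rho>) $ i"
    by (rule integral_bounded_linear[OF bounded_linear_vec_nth])
       (use less_imp_neq[OF A_pos, symmetric] in \<open>auto simp: gauss_def intro!: integrable_cont continuous_intros\<close>)
  finally show ?thesis
    using integral_posterior_mean[OF A A_pos, of x] by simp
qed (rule not_integrable_integral_eq)

text \<open>This is the defining property of a conditional expectation, tested on the events that
  the interpolant lies in \<open>B\<close>.\<close>

lemma integral_interpolant_residual:
  fixes M :: "'w measure" and Z X1 :: "'w \<Rightarrow> real ^ 'n"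
  assumes M: "prob_space M"
    and [measurable]: "Z \<in> borel_measurable M" "X1 \<in> borel_measurable M"
    and laws: "distr M borel Z = gaussian 1" "distr M borel X1 = (gaussian \<sigma> \<star> \<rho>)"
    and indep: "prob_space.indep_var M borel Z borel X1"
    and b: "0 < b" and A: "A = a\<^sup>2 + \<sigma>\<^sup>2 * b\<^sup>2"
    and B [measurable]: "B \<in> sets borel"
    and f: "f = (\<lambda>(x, z). (z $ i - ((a / A) *\<^sub>R (x - b *\<^sub>R posterior_mean a b x)) $ i) * indicator B x)"
    and int: "integrable M (\<lambda>\<omega>. f (a *\<^sub>R Z \<omega> + b *\<^sub>R X1 \<omega>, Z \<omega>))"
  shows "(\<integral>\<omega>. f (a *\<^sub>R Z \<omega> + b *\<^sub>R X1 \<omega>, Z \<omega>) \<partial>M) = 0"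
proof -
  interpret RL: pair_sigma_finite \<rho> lborel ..
  interpret LRL: pair_sigma_finite "lborel :: (real ^ 'n) measure" "\<rho> \<Otimes>\<^sub>M (lborel :: (real ^ 'n) measure)" ..
  let ?N = "(lborel :: (real ^ 'n) measure) \<Otimes>\<^sub>M (\<rho> \<Otimes>\<^sub>M (lborel :: (real ^ 'n) measure))"
  define D where "D = (\<lambda>(x :: real ^ 'n, y :: real ^ 'n, z :: real ^ 'n). gauss (sqrt A) (x - b *\<^sub>R y) * gauss (b * \<sigma> / sqrt A) (z - (a / A) *\<^sub>R (x - b *\<^sub>R y)))"
  define \<pi> where "\<pi> = (\<lambda>(x :: real ^ 'n, y :: real ^ 'n, z :: real ^ 'n). (x, z))"
  have [measurable]: "posterior_mean a b \<in> borel_measurable borel"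
    by (rule borel_measurable_continuous_onI[OF continuous_posterior_mean])
  have f_meas [measurable]: "f \<in> borel_measurable (borel \<Otimes>\<^sub>M borel)" unfolding f by measurable
  have D_meas [measurable]: "D \<in> borel_measurable ?N" unfolding D_def by measurable
  have \<pi>_meas [measurable]: "\<pi> \<in> measurable ?N (borel \<Otimes>\<^sub>M borel)" unfolding \<pi>_def by measurable
  have D_nonneg: "0 \<le> D p" for p by (simp add: D_def split: prod.split)
  let ?Q = "density ?N (\<lambda>p. ennreal (D p))"
  \<comment> \<open>Evaluating the nonnegative formula on indicators identifies the joint law as the
    image under \<pi> of a density on triples (x, y, z); integrability and signed integrals can then
    be transported along it.\<close>
  have law: "distr M (borel \<Otimes>\<^sub>M borel) (\<lambda>\<omega>. (a *\<^sub>R Z \<omega> + b *\<^sub>R X1 \<omega>, Z \<omega>)) = distr ?Q (borel \<Otimes>\<^sub>M borel) \<pi>"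
    (is "?L = ?R")
  proof (rule measure_eqI)
    fix S assume "S \<in> sets ?L"
    then have S [measurable]: "S \<in> sets (borel \<Otimes>\<^sub>M borel)" by simp
    have "emeasure ?L S = (\<integral>\<^sup>+p. indicator S p \<partial>?L)" by simp
    also have "\<dots> = (\<integral>\<^sup>+\<omega>. indicator S (a *\<^sub>R Z \<omega> + b *\<^sub>R X1 \<omega>, Z \<omega>) \<partial>M)"
      by (rule nn_integral_distr) measurable
    also have "\<dots> = (\<integral>\<^sup>+x. \<integral>\<^sup>+y. \<integral>\<^sup>+z. ennreal (D (x, y, z)) * indicator S (\<pi> (x, y, z)) \<partial>lborel \<partial>\<rho> \<partial>lborel)"
      using nn_integral_interpolant[OF M assms(2,3) laws indep b A, of "indicator S"] by (simp add: D_def \<pi>_def)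
    also have "\<dots> = (\<integral>\<^sup>+x. \<integral>\<^sup>+q. ennreal (D (x, q)) * indicator S (\<pi> (x, q)) \<partial>(\<rho> \<Otimes>\<^sub>M lborel) \<partial>lborel)"
      by (intro nn_integral_cong lborel.nn_integral_fst) measurable
    also have "\<dots> = (\<integral>\<^sup>+p. ennreal (D p) * indicator S (\<pi> p) \<partial>?N)"
      by (intro RL.P.nn_integral_fst) measurable
    also have "\<dots> = (\<integral>\<^sup>+p. indicator S (\<pi> p) \<partial>?Q)"
      by (rule nn_integral_density[symmetric]) measurable
    also have "\<dots> = (\<integral>\<^sup>+p. indicator S p \<partial>?R)"
      by (rule nn_integral_distr[symmetric]) measurable
    also have "\<dots> = emeasure ?R S" by simp
    finally show "emeasure ?L S = emeasure ?R S" .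
  qed simp
  have "integrable ?L f"
    using int by (subst integrable_distr_eq) simp_all
  then have "integrable ?Q (\<lambda>p. f (\<pi> p))"
    unfolding law by (subst (asm) integrable_distr_eq) simp_all
  then have int_N: "integrable ?N (\<lambda>p. D p *\<^sub>R f (\<pi> p))"
    by (subst (asm) integrable_density) (auto simp: D_nonneg)
  have "(\<integral>\<omega>. f (a *\<^sub>R Z \<omega> + b *\<^sub>R X1 \<omega>, Z \<omega>) \<partial>M) = integral\<^sup>L ?L f"
    by (rule integral_distr[symmetric]) measurable
  also have "\<dots> = (\<integral>p. f (\<pi> p) \<partial>?Q)"
    unfolding law by (rule integral_distr) measurable
  also have "\<dots> = (\<integral>p. D p *\<^sub>R f (\<pi> p) \<partial>?N)"
    by (rule integral_density) (auto simp: D_nonneg)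
  also have "\<dots> = (\<integral>x. \<integral>q. D (x, q) *\<^sub>R f (\<pi> (x, q)) \<partial>(\<rho> \<Otimes>\<^sub>M lborel) \<partial>lborel)"
    by (rule LRL.integral_fst'[symmetric]) (rule int_N)
  \<comment> \<open>The inner integral is 0 for every x, including those where it fails to converge,
    so the integrands agree pointwise.\<close>
  also have "\<dots> = (\<integral>x. 0 \<partial>(lborel :: (real ^ 'n) measure))"
  proof (intro Bochner_Integration.integral_cong refl)
    fix x
    have "(\<integral>q. D (x, q) *\<^sub>R f (\<pi> (x, q)) \<partial>(\<rho> \<Otimes>\<^sub>M lborel)) =
        (\<integral>q. (case q of (y, z) \<Rightarrow> (gauss (sqrt A) (x - b *\<^sub>R y) * gauss (b * \<sigma> / sqrt A) (z - (a / A) *\<^sub>R (x - b *\<^sub>R y))) *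
      (z $ i - ((a / A) *\<^sub>R (x - b *\<^sub>R posterior_mean a b x)) $ i)) * indicator B x \<partial>(\<rho> \<Otimes>\<^sub>M lborel))"
      by (intro Bochner_Integration.integral_cong refl) (auto simp: D_def f \<pi>_def)
    also have "\<dots> = 0"
      by (simp only: integral_mult_left_zero integral_residual_eq_0[OF b A] mult_zero_left)
    finally show "(\<integral>q. D (x, q) *\<^sub>R f (\<pi> (x, q)) \<partial>(\<rho> \<Otimes>\<^sub>M lborel)) = 0" .
  qed
  finally show ?thesis by simp
qed


text \<open>The candidate \<open>V\<close> is verified rather than derived: it is a continuous
  function of the interpolant, and its residual integrates to zero on the generating events.
  Uniqueness of conditional expectations, continuity and full support then force
  \<open>v t = V\<close>.\<close>

lemma velocity_field_eq:
  fixes M :: "'w measure" and Z X1 :: "'w \<Rightarrow> real ^ 'n" and a b :: "real \<Rightarrow> real"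
  assumes M: "prob_space M"
    and meas [measurable]: "Z \<in> borel_measurable M" "X1 \<in> borel_measurable M"
    and laws: "distr M borel Z = gaussian 1" "distr M borel X1 = (gaussian \<sigma> \<star> \<rho>)"
    and indep: "prob_space.indep_var M borel Z borel X1"
    and v: "velocity_field M a b Z X1 v"
    and t: "0 < t" "t < 1" and b: "0 < b t"
    and A: "A = (a t)\<^sup>2 + \<sigma>\<^sup>2 * (b t)\<^sup>2"
  shows "v t x = ((a t * time_deriv a t + \<sigma>\<^sup>2 * b t * time_deriv b t) / A) *\<^sub>R x +
    (((a t)\<^sup>2 * time_deriv b t - a t * time_deriv a t * b t) / A) *\<^sub>R posterior_mean (a t) (b t) x"
proof -
  interpret M: prob_space M by (rule M)
  interpret G: prob_space "gaussian \<sigma> :: (real ^ 'n) measure" by (rule prob_space_gaussian) (rule \<sigma>_pos)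
  have A_pos: "0 < A" using b \<sigma>_pos by (simp add: A add_nonneg_pos)
  define Y where "Y = interpolant a b Z X1 t"
  have Y: "Y \<omega> = a t *\<^sub>R Z \<omega> + b t *\<^sub>R X1 \<omega>" for \<omega> by (simp add: Y_def interpolant_def)
  have Y_meas [measurable]: "Y \<in> borel_measurable M" unfolding Y by measurable
  define F where "F = vimage_algebra (space M) Y borel"
  have sub: "subalgebra M F"
    using measurable_sets[OF Y_meas] unfolding subalgebra_def F_def by (auto simp: sets_vimage_algebra2)
  then interpret S: finite_measure_subalgebra M F
    by unfold_locales
  have Y_F: "Y \<in> borel_measurable F"
    unfolding F_def by (rule measurable_vimage_algebra1) simp
  define m where "m = posterior_mean (a t) (b t)"
  have m_cont: "continuous_on UNIV m" unfolding m_def by (rule continuous_posterior_mean)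
  have m_meas [measurable]: "m \<in> borel_measurable borel"
    by (rule borel_measurable_continuous_onI[OF m_cont])
  have m_le: "norm (m x) \<le> norm c + R" for x
    using posterior_mean_mem_cball[of "a t" "b t" x] norm_triangle_sub[of "m x" c]
    by (simp add: m_def dist_norm norm_minus_commute)
  \<comment> \<open>The conditional mean of \<open>Z\<close>: given the compact component y it would
    be (a/A)(x - b y), and y is averaged to its posterior mean.\<close>
  define \<zeta> where "\<zeta> x = (a t / A) *\<^sub>R (x - b t *\<^sub>R m x)" for x
  \<comment> \<open>Obtained by eliminating X1 = (Y - a Z)/b from a' Z + b' X1 and replacing
    \<open>Z\<close> by its conditional mean.\<close>
  define V where "V x = (time_deriv b t / b t) *\<^sub>R x + (time_deriv a t - time_deriv b t * a t / b t) *\<^sub>R \<zeta> x" for x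
  have V_cont: "continuous_on UNIV V"
    unfolding V_def \<zeta>_def by (intro continuous_intros m_cont)
  have [measurable]: "V \<in> borel_measurable borel" "\<zeta> \<in> borel_measurable borel"
    unfolding V_def \<zeta>_def by measurable
  have int_gauss: "integrable (gaussian s) (\<lambda>x :: real ^ 'n. x $ i)" if "0 < s" for s i
    using integrable_gauss_coordinate[OF that, of 0 i]
    unfolding gaussian_eq by (subst integrable_density) auto
  have int_Z: "integrable M (\<lambda>\<omega>. Z \<omega> $ i)" for i
  proof -
    have "integrable (distr M borel Z) (\<lambda>x. x $ i)" unfolding laws by (rule int_gauss) simp
    then show ?thesis by (subst (asm) integrable_distr_eq) simp_all
  qed
  have int_X1: "integrable M (\<lambda>\<omega>. X1 \<omega> $ i)" for i
  proof -
    have "(\<integral>\<^sup>+x. ennreal (norm (x $ i)) \<partial>(gaussian \<sigma> \<star> \<rho>)) = (\<integral>\<^sup>+w. \<integral>\<^sup>+y. ennreal (norm ((w + y) $ i)) \<partial>\<rho> \<partial>gaussian \<sigma>)"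
      by (rule nn_integral_convolution) (auto intro: G.finite_measure_axioms finite_measure_axioms)
    also have "\<dots> \<le> (\<integral>\<^sup>+w. \<integral>\<^sup>+y. ennreal (norm (w $ i)) + ennreal (norm (y $ i)) \<partial>\<rho> \<partial>gaussian \<sigma>)"
      by (intro nn_integral_mono) (simp flip: ennreal_plus)
    also have "\<dots> = (\<integral>\<^sup>+w. ennreal (norm (w $ i)) \<partial>gaussian \<sigma>) + (\<integral>\<^sup>+y. ennreal (norm (y $ i)) \<partial>\<rho>)"
      by (simp add: nn_integral_add emeasure_space_1 G.emeasure_space_1)
    also have "\<dots> < \<infinity>"
      using int_gauss[OF \<sigma>_pos, of i] integrable_cont[of "\<lambda>y. y $ i"] continuous_on_component[OF continuous_on_id]
      by (auto simp: integrable_iff_bounded id_def)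
    finally have "integrable (distr M borel X1) (\<lambda>x. x $ i)"
      unfolding laws by (intro integrableI_bounded) simp_all
    then show ?thesis by (subst (asm) integrable_distr_eq) simp_all
  qed
  have int_Y: "integrable M (\<lambda>\<omega>. Y \<omega> $ i)" for i
    unfolding Y using int_Z[of i] int_X1[of i] by simp
  have int_m: "integrable M (\<lambda>\<omega>. m (Y \<omega>) $ i)" for i
  proof (rule M.integrable_const_bound)
    show "AE \<omega> in M. norm (m (Y \<omega>) $ i) \<le> norm c + R"
      using component_le_norm_cart[of "m _" i] m_le by (intro AE_I2) (auto intro: order_trans)
  qed measurable
  have int_\<zeta>: "integrable M (\<lambda>\<omega>. \<zeta> (Y \<omega>) $ i)" for i
    unfolding \<zeta>_def using int_Y[of i] int_m[of i] by simp
  have cond_exp: "AE \<omega> in M. real_cond_exp M F (\<lambda>\<omega>. (time_deriv a t *\<^sub>R Z \<omega> + time_deriv b t *\<^sub>R X1 \<omega>) $ i) \<omega> = V (Y \<omega>) $ i" for i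
  proof (rule S.real_cond_exp_charact)
    let ?\<kappa> = "time_deriv a t - time_deriv b t * a t / b t"
    let ?f = "\<lambda>\<omega>. (time_deriv a t *\<^sub>R Z \<omega> + time_deriv b t *\<^sub>R X1 \<omega>) $ i"
    have diff: "?f \<omega> = V (Y \<omega>) $ i + ?\<kappa> * (Z \<omega> $ i - \<zeta> (Y \<omega>) $ i)" for \<omega>
      using b by (simp add: V_def Y field_simps)
    show int_V: "integrable M (\<lambda>\<omega>. V (Y \<omega>) $ i)"
      unfolding V_def using int_Y[of i] int_\<zeta>[of i] by simp
    show "integrable M ?f"
      using int_Z[of i] int_X1[of i] by simp
    show "(\<lambda>\<omega>. V (Y \<omega>) $ i) \<in> borel_measurable F"
      using Y_F by (rule measurable_compose) measurable
    fix S assume "S \<in> sets F"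
    then obtain B where B [measurable]: "B \<in> sets borel" and S: "S = Y -` B \<inter> space M"
      unfolding F_def by (auto simp: sets_vimage_algebra2)
    define f where "f = (\<lambda>(x, z). (z $ i - ((a t / A) *\<^sub>R (x - b t *\<^sub>R posterior_mean (a t) (b t) x)) $ i) * indicator B x :: real)"
    have S_meas: "S \<in> sets M" unfolding S by measurable
    have f_eq: "indicator S \<omega> *\<^sub>R (Z \<omega> $ i - \<zeta> (Y \<omega>) $ i) = f (a t *\<^sub>R Z \<omega> + b t *\<^sub>R X1 \<omega>, Z \<omega>)" if "\<omega> \<in> space M" for \<omega>
      using that by (simp add: f_def S \<zeta>_def m_def Y indicator_def)
    have "integrable M (\<lambda>\<omega>. indicator S \<omega> *\<^sub>R (Z \<omega> $ i - \<zeta> (Y \<omega>) $ i))"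
      by (intro integrable_mult_indicator S_meas Bochner_Integration.integrable_diff int_Z int_\<zeta>)
    then have int_f: "integrable M (\<lambda>\<omega>. f (a t *\<^sub>R Z \<omega> + b t *\<^sub>R X1 \<omega>, Z \<omega>))"
      by (subst (asm) Bochner_Integration.integrable_cong[OF refl f_eq])
    have 0: "(\<integral>\<omega>. f (a t *\<^sub>R Z \<omega> + b t *\<^sub>R X1 \<omega>, Z \<omega>) \<partial>M) = 0"
      by (rule integral_interpolant_residual[OF M meas laws indep b A B f_def int_f])
    have "(LINT \<omega>:S|M. ?f \<omega>) = (\<integral>\<omega>. indicator S \<omega> *\<^sub>R V (Y \<omega>) $ i + ?\<kappa> * f (a t *\<^sub>R Z \<omega> + b t *\<^sub>R X1 \<omega>, Z \<omega>) \<partial>M)"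
      unfolding set_lebesgue_integral_def diff
      by (intro Bochner_Integration.integral_cong refl) (simp add: f_eq[symmetric] distrib_left)
    also have "\<dots> = (LINT \<omega>:S|M. V (Y \<omega>) $ i)"
      unfolding set_lebesgue_integral_def using 0 int_f integrable_mult_indicator[OF S_meas int_V] by simp
    finally show "(LINT \<omega>:S|M. ?f \<omega>) = (LINT \<omega>:S|M. V (Y \<omega>) $ i)" .
  qed
  have v_cont: "continuous_on UNIV (v t)"
    and v_AE: "\<And>i. AE \<omega> in M. v t (Y \<omega>) $ i =
        real_cond_exp M F (\<lambda>\<omega>. (time_deriv a t *\<^sub>R Z \<omega> + time_deriv b t *\<^sub>R X1 \<omega>) $ i) \<omega>"
    using v t unfolding velocity_field_def F_def Y_def by auto
  have "AE \<omega> in M. v t (Y \<omega>) $ i = V (Y \<omega>) $ i" for i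
    using v_AE[of i] cond_exp[of i] by eventually_elim simp
  then have "AE \<omega> in M. \<forall>i. v t (Y \<omega>) $ i = V (Y \<omega>) $ i"
    by (simp add: AE_all_countable)
  then have "AE \<omega> in M. a t *\<^sub>R Z \<omega> + b t *\<^sub>R X1 \<omega> \<notin> {x. v t x \<noteq> V x}"
    by eventually_elim (simp add: Y[symmetric] vec_eq_iff)
  moreover have "open {x. v t x \<noteq> V x}"
    using v_cont V_cont by (intro open_Collect_neq)
  ultimately have "{x. v t x \<noteq> V x} = {}"
    by (intro interpolant_full_support[OF M meas laws indep b])
  then have "v t x = V x" by auto
  also have "V x = (time_deriv b t / b t + (time_deriv a t - time_deriv b t * a t / b t) * (a t / A)) *\<^sub>R x +
      (- (time_deriv a t - time_deriv b t * a t / b t) * (a t / A) * b t) *\<^sub>R m x"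
    unfolding V_def \<zeta>_def by (simp add: algebra_simps)
  also have "time_deriv b t / b t + (time_deriv a t - time_deriv b t * a t / b t) * (a t / A) =
      (a t * time_deriv a t + \<sigma>\<^sup>2 * b t * time_deriv b t) / A"
    using b A_pos by (simp add: divide_simps) (simp add: A power2_eq_square algebra_simps)
  also have "- (time_deriv a t - time_deriv b t * a t / b t) * (a t / A) * b t =
      ((a t)\<^sup>2 * time_deriv b t - a t * time_deriv a t * b t) / A"
    using b A_pos by (simp add: divide_simps) (simp add: power2_eq_square algebra_simps)
  finally show ?thesis by (simp add: m_def)
qed

end

section \<open>The interpolation flow\<close>

text \<open>The derivative D is compared with \<open>f\<close> on increments s h that are short
  enough for an error e |s h|; dividing by s gives |D h| <= (C + e) |h|, and e is arbitrary.\<close>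

lemma spectral_norm_jacobian_le:
  fixes f :: "real ^ 'n \<Rightarrow> real ^ 'm"
  assumes f: "f differentiable (at x)" and C: "C-lipschitz_on UNIV f"
  shows "spectral_norm (jacobian f (at x)) \<le> C"
  unfolding spectral_norm_def
proof (rule onorm_le)
  fix h
  let ?D = "\<lambda>h. jacobian f (at x) *v h"
  have D: "(f has_derivative ?D) (at x)" using f by (simp add: jacobian_works)
  have "norm (?D h) \<le> C * norm h + e * norm h" if "0 < e" for e
  proof -
    obtain d where d: "0 < d" "\<And>y. norm (y - x) < d \<Longrightarrow> norm (f y - f x - ?D (y - x)) \<le> e * norm (y - x)"
      using D \<open>0 < e\<close> unfolding has_derivative_at_alt by blast
    define s where "s = d / (2 * (norm h + 1))"
    have s: "0 < s" using d(1) by (simp add: s_def add_nonneg_pos)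
    have "norm (s *\<^sub>R h) = d * (norm h / (2 * (norm h + 1)))" using s d(1) by (simp add: s_def)
    also have "\<dots> < d * 1"
      using d(1) by (intro mult_strict_left_mono) (auto simp: divide_simps add_nonneg_pos intro: add_nonneg_pos)
    finally have "norm (f (x + s *\<^sub>R h) - f x - ?D (s *\<^sub>R h)) \<le> e * norm (s *\<^sub>R h)"
      using d(2)[of "x + s *\<^sub>R h"] by simp
    moreover have "norm (f (x + s *\<^sub>R h) - f x) \<le> C * norm (s *\<^sub>R h)"
      using lipschitz_onD[OF C, of "x + s *\<^sub>R h" x] by (simp add: dist_norm)
    ultimately have "norm (?D (s *\<^sub>R h)) \<le> C * norm (s *\<^sub>R h) + e * norm (s *\<^sub>R h)"
      using norm_triangle_sub[of "?D (s *\<^sub>R h)" "f (x + s *\<^sub>R h) - f x"] by (simp add: norm_minus_commute)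
    then have "s * norm (?D h) \<le> s * (C * norm h + e * norm h)"
      using s by (simp add: matrix_vector_mult_scaleR algebra_simps)
    then show ?thesis using s by simp
  qed
  then have "norm (?D h) \<le> C * norm h + e" if "0 < e" for e
  proof (cases "h = 0")
    case False
    then show ?thesis using \<open>\<And>e. 0 < e \<Longrightarrow> _\<close>[of "e / norm h"] that by simp
  qed (use that in simp)
  then show "norm (?D h) \<le> C * norm h" by (rule field_le_epsilon)
qed

lemma is_flow_continuous_on: "is_flow w X \<Longrightarrow> continuous_on {0..1} (\<lambda>t. X t x)"
  unfolding is_flow_def continuous_on_eq_continuous_within
  by (blast intro: has_vector_derivative_continuous)

lemma is_flow_has_vector_derivative:
  assumes "is_flow w X" "0 < t" "t < 1"
  shows "((\<lambda>s. X s x) has_vector_derivative w t (X t x)) (at t)"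
proof -
  have "((\<lambda>s. X s x) has_vector_derivative w t (X t x)) (at t within {0..1})"
    using assms unfolding is_flow_def by simp
  then show ?thesis using assms by (simp add: at_within_Icc_at)
qed

lemma C2_on_has_time_deriv:
  assumes "C2_on {0..<1} f" "0 < t" "t < 1"
  shows "(f has_real_derivative time_deriv f t) (at t)"
proof -
  obtain f' where "\<forall>t\<in>{0..<1}. (f has_real_derivative f' t) (at t within {0..<1})"
    using assms unfolding C2_on_def by blast
  moreover have "at t within {0..<1} = at t"
    using assms(2,3) by (intro at_within_interior) simp
  ultimately have f': "(f has_real_derivative f' t) (at t)"
    using assms(2,3) by (metis atLeastLessThan_iff less_imp_le)
  then have "time_deriv f t = f' t"
    unfolding time_deriv_def has_real_derivative_iff_has_vector_derivative
    using assms by (intro vector_derivative_at_within_ivl) auto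
  with f' show ?thesis by simp
qed

lemma C1_on_continuous_on: "C1_on S f \<Longrightarrow> continuous_on S f"
  unfolding C1_on_def by (auto intro: DERIV_continuous_on)

section \<open>Jacobian and one-sided bounds of the posterior mean\<close>

context gaussian_convolution
begin

text \<open>The Jacobian of \<open>posterior_mean a b\<close> at x: the factor comes from the chain
  rule, since the tilt parameter is a multiple of x.\<close>

definition posterior_cov :: "real \<Rightarrow> real \<Rightarrow> real ^ 'n \<Rightarrow> real ^ 'n \<Rightarrow> real ^ 'n" where
  "posterior_cov a b x h = (b / (a\<^sup>2 + \<sigma>\<^sup>2 * b\<^sup>2)) *\<^sub>R
     covariance (tilt (posterior_base a b) ((b / (a\<^sup>2 + \<sigma>\<^sup>2 * b\<^sup>2)) *\<^sub>R x)) h"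

context
  fixes a b A :: real
  assumes b: "0 < b" and A: "A = a\<^sup>2 + \<sigma>\<^sup>2 * b\<^sup>2"
begin

lemma A_pos: "0 < A"
  using b \<sigma>_pos by (simp add: A add_nonneg_pos)

lemma linear_posterior_cov: "linear (posterior_cov a b x)"
proof -
  interpret P: bounded_support "posterior_base a b" c R by (rule bounded_support_posterior_base)
  interpret T: bounded_support "tilt (posterior_base a b) ((b / (a\<^sup>2 + \<sigma>\<^sup>2 * b\<^sup>2)) *\<^sub>R x)" c R
    by (rule P.bounded_support_tilt)
  show ?thesis
    unfolding posterior_cov_def[abs_def] by (intro linear_compose_scale_right T.linear_covariance)
qed

lemma posterior_cov_inner_bounds:
  shows "0 \<le> posterior_cov a b x h \<bullet> h" and "posterior_cov a b x h \<bullet> h \<le> b / A * R\<^sup>2 * (norm h)\<^sup>2"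
proof -
  interpret P: bounded_support "posterior_base a b" c R by (rule bounded_support_posterior_base)
  interpret T: bounded_support "tilt (posterior_base a b) ((b / (a\<^sup>2 + \<sigma>\<^sup>2 * b\<^sup>2)) *\<^sub>R x)" c R
    by (rule P.bounded_support_tilt)
  let ?C = "covariance (tilt (posterior_base a b) ((b / (a\<^sup>2 + \<sigma>\<^sup>2 * b\<^sup>2)) *\<^sub>R x)) h \<bullet> h"
  have l: "0 \<le> b / A" using b A_pos by simp
  have eq: "posterior_cov a b x h \<bullet> h = b / A * ?C"
    by (simp only: posterior_cov_def A inner_scaleR_left)
  note bounds = T.covariance_inner_bounds[OF P.prob_space_tilt, of h]
  show "0 \<le> posterior_cov a b x h \<bullet> h"
    unfolding eq using l bounds(1) by (rule mult_nonneg_nonneg)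
  show "posterior_cov a b x h \<bullet> h \<le> b / A * R\<^sup>2 * (norm h)\<^sup>2"
    unfolding eq mult.assoc using bounds(2) l by (rule mult_left_mono)
qed

text \<open>\<open>mean_rem\<close> depends on \<open>R\<close> alone, so the same constant holds at
  all times although the base measure changes; the time dependence is isolated in (b/A)^2.\<close>

lemma posterior_mean_remainder:
  "norm (posterior_mean a b (x + h) - posterior_mean a b x - posterior_cov a b x h) \<le> mean_rem * (b / A)\<^sup>2 * (norm h)\<^sup>2"
proof -
  interpret P: bounded_support "posterior_base a b" c R by (rule bounded_support_posterior_base)
  let ?l = "b / A"
  interpret T: bounded_support "tilt (posterior_base a b) (?l *\<^sub>R x)" c R
    by (rule P.bounded_support_tilt)
  have "norm (mean (tilt (posterior_base a b) (?l *\<^sub>R x + ?l *\<^sub>R h)) - mean (tilt (posterior_base a b) (?l *\<^sub>R x)) -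
      covariance (tilt (posterior_base a b) (?l *\<^sub>R x)) (?l *\<^sub>R h)) \<le> mean_rem * (norm (?l *\<^sub>R h))\<^sup>2"
    by (rule P.mean_tilt_remainder)
  then show ?thesis
    by (simp add: posterior_mean_def posterior_cov_def A[symmetric] scaleR_add_right power_mult_distrib
        linear_scale[OF T.linear_covariance] power_divide mult.assoc)
qed

lemma posterior_mean_one_sided:
  shows "0 \<le> (posterior_mean a b y - posterior_mean a b x) \<bullet> (y - x)"
    and "(posterior_mean a b y - posterior_mean a b x) \<bullet> (y - x) \<le> b / A * R\<^sup>2 * (norm (y - x))\<^sup>2"
proof -
  interpret P: bounded_support "posterior_base a b" c R by (rule bounded_support_posterior_base)
  let ?l = "b / A" and ?d = "(posterior_mean a b y - posterior_mean a b x) \<bullet> (y - x)"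
  have l: "0 < ?l" using b A_pos by simp
  have "posterior_mean a b y = mean (tilt (posterior_base a b) (?l *\<^sub>R x + ?l *\<^sub>R (y - x)))"
      "posterior_mean a b x = mean (tilt (posterior_base a b) (?l *\<^sub>R x))"
    by (simp_all add: posterior_mean_def A[symmetric] flip: scaleR_add_right)
  \<comment> \<open>The increment of the tilt parameter is l (y - x), so the inner product carries
    one factor l and the upper bound two; one of them cancels because l > 0.\<close>
  then have "0 \<le> ?l * ?d" "?l * ?d \<le> R\<^sup>2 * (norm (?l *\<^sub>R (y - x)))\<^sup>2"
    using P.mean_tilt_one_sided[of "?l *\<^sub>R x" "?l *\<^sub>R (y - x)"] by simp_all
  moreover have "R\<^sup>2 * (norm (?l *\<^sub>R (y - x)))\<^sup>2 = ?l * (?l * R\<^sup>2 * (norm (y - x))\<^sup>2)"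
    using l by (simp only: norm_scaleR power_mult_distrib power2_abs) (simp add: power2_eq_square)
  ultimately show "0 \<le> ?d" "?d \<le> ?l * R\<^sup>2 * (norm (y - x))\<^sup>2"
    using l by (simp_all only: zero_le_mult_iff mult_le_cancel_left_pos) auto
qed

end

section \<open>Lipschitz constants and differentiability of the two time-one maps\<close>

lemma interpolation_flow:
  assumes coeffs: "interpolation_coeffs a b"
    and v: "\<And>t x. 0 < t \<Longrightarrow> t < 1 \<Longrightarrow> v t x =
      ((a t * time_deriv a t + \<sigma>\<^sup>2 * b t * time_deriv b t) / ((a t)\<^sup>2 + \<sigma>\<^sup>2 * (b t)\<^sup>2)) *\<^sub>R x +
      (((a t)\<^sup>2 * time_deriv b t - a t * time_deriv a t * b t) / ((a t)\<^sup>2 + \<sigma>\<^sup>2 * (b t)\<^sup>2)) *\<^sub>R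
        posterior_mean (a t) (b t) x"
  shows interpolation_flow_forward: "is_flow v X \<Longrightarrow>
      (\<forall>x. X 1 differentiable (at x)) \<and>
      (\<sigma> / sqrt ((a 0)\<^sup>2 + \<sigma>\<^sup>2 * (b 0)\<^sup>2) *
        exp ((a 0)\<^sup>2 / ((a 0)\<^sup>2 + \<sigma>\<^sup>2 * (b 0)\<^sup>2) * (R\<^sup>2 / (2 * \<sigma>\<^sup>2))))-lipschitz_on UNIV (X 1)"
    and interpolation_flow_backward: "is_flow (\<lambda>t x. - v (1 - t) x) Xrev \<Longrightarrow>
      (\<forall>x. Xrev 1 differentiable (at x)) \<and>
      (sqrt ((a 0)\<^sup>2 / \<sigma>\<^sup>2 + (b 0)\<^sup>2))-lipschitz_on UNIV (Xrev 1)"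
proof -
  define A where "A t = (a t)\<^sup>2 + \<sigma>\<^sup>2 * (b t)\<^sup>2" for t
  define \<alpha> where "\<alpha> t = (a t * time_deriv a t + \<sigma>\<^sup>2 * b t * time_deriv b t) / A t" for t
  define \<beta> where "\<beta> t = ((a t)\<^sup>2 * time_deriv b t - a t * time_deriv a t * b t) / A t" for t
  define w where "w t = (b t)\<^sup>2 / A t" for t
  have a_deriv: "(a has_real_derivative time_deriv a t) (at t)"
    and b_deriv: "(b has_real_derivative time_deriv b t) (at t)"
    and ab_pos: "0 < a t" "0 < b t" and ab': "time_deriv a t \<le> 0" "0 \<le> time_deriv b t"
    if "0 < t" "t < 1" for t
    using coeffs that unfolding interpolation_coeffs_def by (auto intro: C2_on_has_time_deriv)
  have ends: "0 < a 0" "a 1 = 0" "b 1 = 1"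
    using coeffs unfolding interpolation_coeffs_def by auto
  \<comment> \<open>At time 1 regularity is assumed for the square of \<open>a\<close>, not for
    \<open>a\<close> itself; \<open>A\<close> depends on \<open>a\<close> only through its
    square.\<close>
  have b_cont: "continuous_on {0..1} b" and a2_cont: "continuous_on {0..1} (\<lambda>t. (a t)\<^sup>2)"
    using coeffs unfolding interpolation_coeffs_def by (auto intro: C1_on_continuous_on)
  have A_cont: "continuous_on {0..1} A"
    unfolding A_def by (intro continuous_intros b_cont a2_cont)
  \<comment> \<open>At time 0 \<open>b\<close> may vanish and positivity comes from a(0) > 0; at all
    later times, including 1 where \<open>a\<close> vanishes, it comes from b > 0.\<close>
  have A_pos: "0 < A t" if "0 \<le> t" "t \<le> 1" for t
  proof (cases "t = 0")
    case True then show ?thesis using ends by (simp add: A_def add_pos_nonneg)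
  next
    case False
    then have "b t \<noteq> 0" using that ab_pos(2)[of t] ends by (cases "t = 1") auto
    then show ?thesis using \<sigma>_pos by (simp add: A_def add_nonneg_pos)
  qed
  have A_neq: "A t \<noteq> 0" if "0 \<le> t" "t \<le> 1" for t
    using A_pos[OF that] by simp
  \<comment> \<open>The monotonicity of the coefficients enters here: a' <= 0 <= b' makes both terms
    of the numerator nonnegative. This sign lets the covariance bounds pass to \<open>v\<close>
    without reversal.\<close>
  have \<beta>_nonneg: "0 \<le> \<beta> t" if "0 < t" "t < 1" for t
    unfolding \<beta>_def using that ab_pos[OF that] ab'[OF that] A_pos[of t]
    by (intro divide_nonneg_nonneg) (auto simp: mult_nonneg_nonpos mult_nonpos_nonneg intro: order_trans[of _ 0])
  have A_deriv: "(A has_real_derivative 2 * \<alpha> t * A t) (at t)" if "0 < t" "t < 1" for t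
  proof -
    have "2 * \<alpha> t * A t = 2 * (a t * time_deriv a t + \<sigma>\<^sup>2 * b t * time_deriv b t)"
      using A_pos[of t] that by (simp add: \<alpha>_def)
    then show ?thesis
      unfolding A_def[abs_def] using that
      by (auto intro!: derivative_eq_intros a_deriv b_deriv simp: algebra_simps)
  qed
  have lnA_deriv: "((\<lambda>t. ln (A t) / 2) has_real_derivative \<alpha> t) (at t)" if "0 < t" "t < 1" for t
    using A_pos[of t] that by (auto intro!: derivative_eq_intros A_deriv)
  have lnA_cont: "continuous_on {0..1} (\<lambda>t. ln (A t) / 2)"
    by (intro continuous_intros A_cont) (auto simp: A_neq)
  have w_deriv: "(w has_real_derivative 2 * \<beta> t * b t / A t) (at t)" if t: "0 < t" "t < 1" for t
  proof -
    have "(w has_real_derivative (2 * b t * time_deriv b t * A t - (b t)\<^sup>2 * (2 * \<alpha> t * A t)) / (A t * A t)) (at t)"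
      unfolding w_def[abs_def] using A_pos[of t] t
      by (auto intro!: derivative_eq_intros A_deriv b_deriv)
    also have "(2 * b t * time_deriv b t * A t - (b t)\<^sup>2 * (2 * \<alpha> t * A t)) / (A t * A t) = 2 * \<beta> t * b t / A t"
    proof -
      have "\<alpha> t * A t = a t * time_deriv a t + \<sigma>\<^sup>2 * b t * time_deriv b t"
        "\<beta> t * A t = (a t)\<^sup>2 * time_deriv b t - a t * time_deriv a t * b t"
        using A_pos[of t] t by (simp_all add: \<alpha>_def \<beta>_def)
      then have "2 * b t * time_deriv b t * A t - (b t)\<^sup>2 * (2 * \<alpha> t * A t) = 2 * b t * (\<beta> t * A t)"
        by (simp add: mult.assoc) (simp add: A_def power2_eq_square algebra_simps)
      then show ?thesis using A_pos[of t] t by simp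
    qed
    finally show ?thesis .
  qed
  have w_cont: "continuous_on {0..1} w"
    unfolding w_def by (intro continuous_intros A_cont b_cont) (auto simp: A_neq)
  have "bdd_above ((\<lambda>t. b t / A t) ` {0..1})"
    by (intro bounded_imp_bdd_above compact_imp_bounded compact_continuous_image continuous_intros A_cont b_cont)
      (auto simp: A_neq)
  then obtain B where B: "\<And>t. t \<in> {0..1} \<Longrightarrow> b t / A t \<le> B"
    unfolding bdd_above_def by blast
  \<comment> \<open>The Taylor remainder of \<open>v t\<close> has coefficient \<beta> times
    \<open>mean_rem\<close> times (b/A)^2. One factor b/A is bounded by \<open>B\<close>, and
    \<beta> b/A is half the derivative of \<open>w\<close>; hence the remainder is dominated by the
    derivative of a multiple of \<open>w\<close>, which is continuous on [0,1].\<close>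
  define \<kappa> where "\<kappa> t = mean_rem * B / 2 * w t" for t
  define \<kappa>' where "\<kappa>' t = mean_rem * B * (\<beta> t * b t / A t)" for t
  have B_nonneg: "0 \<le> B" using B[of 1] ends A_pos[of 1] by (auto intro: order_trans[of _ "b 1 / A 1"])
  have \<kappa>_deriv: "(\<kappa> has_real_derivative \<kappa>' t) (at t)" if "0 < t" "t < 1" for t
    unfolding \<kappa>_def[abs_def] \<kappa>'_def by (auto intro!: derivative_eq_intros w_deriv that)
  have \<kappa>_cont: "continuous_on {0..1} \<kappa>"
    unfolding \<kappa>_def[abs_def] by (intro continuous_intros w_cont)
  have \<kappa>'_nonneg: "0 \<le> \<kappa>' t" if "0 < t" "t < 1" for t
    unfolding \<kappa>'_def using mean_rem_nonneg B_nonneg \<beta>_nonneg[OF that] ab_pos[OF that] A_pos[of t] that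
    by (auto intro!: mult_nonneg_nonneg divide_nonneg_nonneg)
  have \<kappa>'_ge: "\<beta> t * (mean_rem * (b t / A t)\<^sup>2) \<le> \<kappa>' t" if t: "0 < t" "t < 1" for t
  proof -
    have "\<beta> t * (mean_rem * (b t / A t)\<^sup>2) = mean_rem * (b t / A t) * (\<beta> t * b t / A t)"
      by (simp add: power2_eq_square)
    also have "\<dots> \<le> mean_rem * B * (\<beta> t * b t / A t)"
      using mean_rem_nonneg B[of t] \<beta>_nonneg[OF t] ab_pos[OF t] A_pos[of t] t
      by (intro mult_right_mono mult_left_mono) auto
    finally show ?thesis by (simp add: \<kappa>'_def)
  qed
  have v': "v t x = \<alpha> t *\<^sub>R x + \<beta> t *\<^sub>R posterior_mean (a t) (b t) x" if "0 < t" "t < 1" for t x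
    unfolding v[OF that] \<alpha>_def \<beta>_def A_def ..
  define L where "L t x h = \<alpha> t *\<^sub>R h + \<beta> t *\<^sub>R posterior_cov (a t) (b t) x h" for t x h
  have L_linear: "linear (L t x)" if "0 < t" "t < 1" for t x
    unfolding L_def[abs_def]
    by (intro linear_compose_add linear_compose_scale_right linear_posterior_cov[OF ab_pos(2)[OF that] A_def] linear_ident)
  have L_bounds: "\<alpha> t * (norm h)\<^sup>2 \<le> L t x h \<bullet> h" "L t x h \<bullet> h \<le> (\<alpha> t + R\<^sup>2 * (\<beta> t * b t / A t)) * (norm h)\<^sup>2"
    if t: "0 < t" "t < 1" for t x h
  proof -
    note bounds = posterior_cov_inner_bounds[OF ab_pos(2)[OF t] A_def, of x h]
    have "L t x h \<bullet> h = \<alpha> t * (norm h)\<^sup>2 + \<beta> t * (posterior_cov (a t) (b t) x h \<bullet> h)"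
      by (simp add: L_def inner_add_left power2_norm_eq_inner)
    then show "\<alpha> t * (norm h)\<^sup>2 \<le> L t x h \<bullet> h" "L t x h \<bullet> h \<le> (\<alpha> t + R\<^sup>2 * (\<beta> t * b t / A t)) * (norm h)\<^sup>2"
      using mult_nonneg_nonneg[OF \<beta>_nonneg[OF t] bounds(1)] mult_left_mono[OF bounds(2) \<beta>_nonneg[OF t]]
      by (simp_all add: algebra_simps)
  qed
  have v_one_sided: "\<alpha> t * (norm (y - x))\<^sup>2 \<le> (v t y - v t x) \<bullet> (y - x)"
      "(v t y - v t x) \<bullet> (y - x) \<le> (\<alpha> t + R\<^sup>2 * (\<beta> t * b t / A t)) * (norm (y - x))\<^sup>2"
    if t: "0 < t" "t < 1" for t x y
  proof -
    note bounds = posterior_mean_one_sided[OF ab_pos(2)[OF t] A_def, of y x]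
    have "v t y - v t x = \<alpha> t *\<^sub>R (y - x) + \<beta> t *\<^sub>R (posterior_mean (a t) (b t) y - posterior_mean (a t) (b t) x)"
      unfolding v'[OF t] by (simp add: algebra_simps)
    then have "(v t y - v t x) \<bullet> (y - x) = \<alpha> t * (norm (y - x))\<^sup>2 +
        \<beta> t * ((posterior_mean (a t) (b t) y - posterior_mean (a t) (b t) x) \<bullet> (y - x))"
      by (simp only: inner_add_left inner_scaleR_left power2_norm_eq_inner)
    then show "\<alpha> t * (norm (y - x))\<^sup>2 \<le> (v t y - v t x) \<bullet> (y - x)"
      "(v t y - v t x) \<bullet> (y - x) \<le> (\<alpha> t + R\<^sup>2 * (\<beta> t * b t / A t)) * (norm (y - x))\<^sup>2"
      using mult_nonneg_nonneg[OF \<beta>_nonneg[OF t] bounds(1)] mult_left_mono[OF bounds(2) \<beta>_nonneg[OF t]]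
      by (simp_all add: algebra_simps)
  qed
  have v_remainder: "norm (v t (y + h) - v t y - L t y h) \<le> \<kappa>' t * (norm h)\<^sup>2" if t: "0 < t" "t < 1" for t y h
  proof -
    have "v t (y + h) - v t y - L t y h = \<beta> t *\<^sub>R (posterior_mean (a t) (b t) (y + h) - posterior_mean (a t) (b t) y -
        posterior_cov (a t) (b t) y h)"
      unfolding v'[OF t] L_def by (simp add: algebra_simps)
    then have "norm (v t (y + h) - v t y - L t y h) \<le> \<beta> t * (mean_rem * (b t / A t)\<^sup>2 * (norm h)\<^sup>2)"
      using posterior_mean_remainder[OF ab_pos(2)[OF t] A_def, of y h] \<beta>_nonneg[OF t]
      by (simp add: mult_left_mono)
    also have "\<dots> = (\<beta> t * (mean_rem * (b t / A t)\<^sup>2)) * (norm h)\<^sup>2" by simp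
    also have "\<dots> \<le> \<kappa>' t * (norm h)\<^sup>2" by (intro mult_right_mono \<kappa>'_ge t) simp
    finally show ?thesis .
  qed
  have A_ends: "A 0 = (a 0)\<^sup>2 + \<sigma>\<^sup>2 * (b 0)\<^sup>2" "A 1 = \<sigma>\<^sup>2" by (simp_all add: A_def ends)
  have lnA_ends: "ln (A 0) / 2 = ln (sqrt (A 0))" "ln (A 1) / 2 = ln \<sigma>"
    using A_pos[of 0] \<sigma>_pos by (simp_all add: ln_sqrt A_ends(2) ln_realpow)
  show "(\<forall>x. X 1 differentiable (at x)) \<and>
      (\<sigma> / sqrt ((a 0)\<^sup>2 + \<sigma>\<^sup>2 * (b 0)\<^sup>2) *
        exp ((a 0)\<^sup>2 / ((a 0)\<^sup>2 + \<sigma>\<^sup>2 * (b 0)\<^sup>2) * (R\<^sup>2 / (2 * \<sigma>\<^sup>2))))-lipschitz_on UNIV (X 1)"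
    if X: "is_flow v X"
  proof -
    \<comment> \<open>A primitive of the upper one-sided bound: half of ln A accounts for the linear
      part and R^2/2 times \<open>w\<close> for the covariance part. Its increment is the logarithm
      of the Lipschitz constant.\<close>
    define \<theta> where "\<theta> t = ln (A t) / 2 + R\<^sup>2 / 2 * w t" for t
    interpret flow: one_sided_flow v X \<theta> "\<lambda>t. \<alpha> t + R\<^sup>2 * (\<beta> t * b t / A t)"
    proof
      show "X 0 x = x" for x using X by (simp add: is_flow_def)
      show "continuous_on {0..1} (\<lambda>t. X t x)" for x using X by (rule is_flow_continuous_on)
      show "continuous_on {0..1} \<theta>" unfolding \<theta>_def[abs_def] by (intro continuous_intros lnA_cont w_cont)
      fix t :: real assume t: "0 < t" "t < 1"
      show "((\<lambda>s. X s x) has_vector_derivative v t (X t x)) (at t)" for x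
        using X t by (rule is_flow_has_vector_derivative)
      show "(\<theta> has_real_derivative \<alpha> t + R\<^sup>2 * (\<beta> t * b t / A t)) (at t)"
        using DERIV_add[OF lnA_deriv[OF t] DERIV_cmult[OF w_deriv[OF t], of "R\<^sup>2 / 2"]]
        by (simp add: \<theta>_def[abs_def] mult.assoc)
    qed (rule v_one_sided(2))
    have "exp (\<theta> 1 - \<theta> 0) = \<sigma> / sqrt (A 0) * exp ((a 0)\<^sup>2 / A 0 * (R\<^sup>2 / (2 * \<sigma>\<^sup>2)))"
    proof -
      have "R\<^sup>2 / 2 * w 1 - R\<^sup>2 / 2 * w 0 = (a 0)\<^sup>2 / A 0 * (R\<^sup>2 / (2 * \<sigma>\<^sup>2))"
      proof -
        \<comment> \<open>This increment is the origin of the exponent: w(1) = 1/\<sigma>^2, and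
          A(0) - \<sigma>^2 b(0)^2 = a(0)^2.\<close>
        have "w 1 - w 0 = (A 0 - \<sigma>\<^sup>2 * (b 0)\<^sup>2) / (A 0 * \<sigma>\<^sup>2)"
          using A_pos[of 0] \<sigma>_pos by (simp add: w_def A_ends(2) ends field_simps)
        also have "\<dots> = (a 0)\<^sup>2 / (A 0 * \<sigma>\<^sup>2)" by (simp add: A_ends(1))
        finally have "w 1 - w 0 = (a 0)\<^sup>2 / (A 0 * \<sigma>\<^sup>2)" .
        moreover have "R\<^sup>2 / 2 * w 1 - R\<^sup>2 / 2 * w 0 = R\<^sup>2 / 2 * (w 1 - w 0)"
          by (simp only: right_diff_distrib)
        ultimately show ?thesis by (simp add: mult_ac)
      qed
      then have "\<theta> 1 - \<theta> 0 = (ln \<sigma> - ln (sqrt (A 0))) + (a 0)\<^sup>2 / A 0 * (R\<^sup>2 / (2 * \<sigma>\<^sup>2))"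
        by (simp add: \<theta>_def lnA_ends)
      then show ?thesis using A_pos[of 0] \<sigma>_pos by (simp add: exp_add exp_diff)
    qed
    then have "norm (X 1 y - X 1 x) \<le> \<sigma> / sqrt (A 0) * exp ((a 0)\<^sup>2 / A 0 * (R\<^sup>2 / (2 * \<sigma>\<^sup>2))) * norm (y - x)" for x y
      using flow.flow_dist_le[of 1 y x] by simp
    then show ?thesis
      using flow.flow_differentiable[OF \<kappa>_cont \<kappa>_deriv \<kappa>'_nonneg L_linear L_bounds(2) v_remainder] \<sigma>_pos A_pos[of 0]
      unfolding A_ends(1) by (auto intro!: lipschitz_onI simp: dist_norm)
  qed
  have refl_cont: "continuous_on {0..1} (\<lambda>t. f (1 - t))" if "continuous_on {0..1} f" for f :: "real \<Rightarrow> real"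
    by (rule continuous_on_compose2[OF that]) (auto intro!: continuous_intros)
  have refl_deriv: "((\<lambda>t. f (1 - t)) has_real_derivative - d) (at t)"
    if "(f has_real_derivative d) (at (1 - t))" for f :: "real \<Rightarrow> real" and d t
  proof -
    have "((\<lambda>t. 1 - t) has_real_derivative - 1) (at t)" by (auto intro!: derivative_eq_intros)
    from DERIV_chain2[OF that this] show ?thesis by simp
  qed
  show "(\<forall>x. Xrev 1 differentiable (at x)) \<and>
      (sqrt ((a 0)\<^sup>2 / \<sigma>\<^sup>2 + (b 0)\<^sup>2))-lipschitz_on UNIV (Xrev 1)"
    if X: "is_flow (\<lambda>t x. - v (1 - t) x) Xrev"
  proof -
    \<comment> \<open>Negating the field turns its lower one-sided bound into an upper one. The
      lower bound discards the covariance, so \<open>R\<close> disappears from this constant, and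
      the increment of the reversed exponent is (ln A(0) - ln A(1))/2.\<close>
    interpret flow: one_sided_flow "\<lambda>t x. - v (1 - t) x" Xrev "\<lambda>t. ln (A (1 - t)) / 2" "\<lambda>t. - \<alpha> (1 - t)"
    proof
      show "Xrev 0 x = x" for x using X by (simp add: is_flow_def)
      show "continuous_on {0..1} (\<lambda>t. Xrev t x)" for x using X by (rule is_flow_continuous_on)
      show "continuous_on {0..1} (\<lambda>t. ln (A (1 - t)) / 2)" by (rule refl_cont[OF lnA_cont])
      fix t :: real assume t: "0 < t" "t < 1"
      show "((\<lambda>s. Xrev s x) has_vector_derivative - v (1 - t) (Xrev t x)) (at t)" for x
        using is_flow_has_vector_derivative[OF X t] .
      show "((\<lambda>t. ln (A (1 - t)) / 2) has_real_derivative - \<alpha> (1 - t)) (at t)"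
        using t by (intro refl_deriv[OF lnA_deriv]) auto
      show "(- v (1 - t) y - - v (1 - t) x) \<bullet> (y - x) \<le> - \<alpha> (1 - t) * (norm (y - x))\<^sup>2" for x y
        using v_one_sided(1)[of "1 - t" y x] t by (simp add: inner_diff_left)
    qed
    have "exp (ln (A (1 - 1)) / 2 - ln (A (1 - 0)) / 2) = sqrt (A 0) / \<sigma>"
      using A_pos[of 0] \<sigma>_pos by (simp add: lnA_ends exp_diff)
    also have "\<dots> = sqrt ((a 0)\<^sup>2 / \<sigma>\<^sup>2 + (b 0)\<^sup>2)"
    proof -
      have "(a 0)\<^sup>2 / \<sigma>\<^sup>2 + (b 0)\<^sup>2 = A 0 / \<sigma>\<^sup>2" using \<sigma>_pos by (simp add: A_ends(1) field_simps)
      then show ?thesis using \<sigma>_pos by (simp add: real_sqrt_divide)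
    qed
    finally have "norm (Xrev 1 y - Xrev 1 x) \<le> sqrt ((a 0)\<^sup>2 / \<sigma>\<^sup>2 + (b 0)\<^sup>2) * norm (y - x)" for x y
      using flow.flow_dist_le[of 1 y x] by simp
    moreover have "Xrev 1 differentiable (at x)" for x
    \<comment> \<open>Reversing time changes the sign of a derivative, so the nonnegative weight
      \<kappa>'(1 - t) has the primitive -\<kappa>(1 - t).\<close>
    proof (rule flow.flow_differentiable[where k = "\<lambda>t. - \<kappa> (1 - t)" and k' = "\<lambda>t. \<kappa>' (1 - t)" and L = "\<lambda>t y h. - L (1 - t) y h"])
      show "continuous_on {0..1} (\<lambda>t. - \<kappa> (1 - t))" by (intro continuous_intros refl_cont \<kappa>_cont)
      fix t :: real assume t: "0 < t" "t < 1"
      then have t': "0 < 1 - t" "1 - t < 1" by auto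
      show "((\<lambda>t. - \<kappa> (1 - t)) has_real_derivative \<kappa>' (1 - t)) (at t)"
        using DERIV_minus[OF refl_deriv[OF \<kappa>_deriv[OF t']]] by simp
      show "0 \<le> \<kappa>' (1 - t)" using t' by (rule \<kappa>'_nonneg)
      show "linear (\<lambda>h. - L (1 - t) y h)" for y by (intro linear_compose_neg L_linear t')
      show "- L (1 - t) y h \<bullet> h \<le> - \<alpha> (1 - t) * (norm h)\<^sup>2" for y h using L_bounds(1)[OF t', of h y] by simp
      show "norm (- v (1 - t) (y + h) - - v (1 - t) y - - L (1 - t) y h) \<le> \<kappa>' (1 - t) * (norm h)\<^sup>2" for y h
        using v_remainder[OF t', of y h]
        by (subst norm_minus_cancel[symmetric]) (simp add: algebra_simps)
    qed
    ultimately show ?thesis by (auto intro!: lipschitz_onI simp: dist_norm)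
  qed
qed

end

theorem proposition31:
  fixes a b :: "real \<Rightarrow> real"
    and M :: "'w measure" and Z X1 :: "'w \<Rightarrow> real ^ 'n"
    and \<nu> \<rho> :: "(real ^ 'n) measure" and c :: "real ^ 'n" and \<sigma> R :: real
    and v X Xrev :: "real \<Rightarrow> real ^ 'n \<Rightarrow> real ^ 'n"
  assumes "interpolation_coeffs a b"
    and "\<sigma> > 0"
    and "prob_space \<rho>" and "sets \<rho> = sets borel" and "supp \<rho> \<subseteq> cball c R"
    and "\<nu> = (gaussian \<sigma> \<star> \<rho>)"
    and "prob_space M"
    and "Z \<in> borel_measurable M" and "distr M borel Z = gaussian 1"
    and "X1 \<in> borel_measurable M" and "distr M borel X1 = \<nu>"
    and "prob_space.indep_var M borel Z borel X1"
    and "velocity_field M a b Z X1 v"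
    and "is_flow v X"
    and "is_flow (\<lambda>t x. - v (1 - t) x) Xrev"
  shows
    "(\<sigma> / sqrt ((a 0)\<^sup>2 + \<sigma>\<^sup>2 * (b 0)\<^sup>2) *
        exp ((a 0)\<^sup>2 / ((a 0)\<^sup>2 + \<sigma>\<^sup>2 * (b 0)\<^sup>2) * (R\<^sup>2 / (2 * \<sigma>\<^sup>2))))-lipschitz_on UNIV (X 1) \<and>
     (\<forall>x. X 1 differentiable (at x) \<and>
        spectral_norm (jacobian (X 1) (at x)) \<le>
          \<sigma> / sqrt ((a 0)\<^sup>2 + \<sigma>\<^sup>2 * (b 0)\<^sup>2) *
          exp ((a 0)\<^sup>2 / ((a 0)\<^sup>2 + \<sigma>\<^sup>2 * (b 0)\<^sup>2) * (R\<^sup>2 / (2 * \<sigma>\<^sup>2)))) \<and>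
     (a 0 = 1 \<and> b 0 = 0 \<longrightarrow>
        (\<forall>x. spectral_norm (jacobian (X 1) (at x)) \<le> \<sigma> * exp (R\<^sup>2 / (2 * \<sigma>\<^sup>2)))) \<and>
     (sqrt ((a 0)\<^sup>2 / \<sigma>\<^sup>2 + (b 0)\<^sup>2))-lipschitz_on (supp \<nu>) (Xrev 1) \<and>
     (\<forall>x\<in>supp \<nu>. Xrev 1 differentiable (at x) \<and>
        spectral_norm (jacobian (Xrev 1) (at x)) \<le> sqrt ((a 0)\<^sup>2 / \<sigma>\<^sup>2 + (b 0)\<^sup>2)) \<and>
     (a 0 = 1 \<and> b 0 = 0 \<longrightarrow>
        (\<forall>x\<in>supp \<nu>. spectral_norm (jacobian (Xrev 1) (at x)) \<le> 1 / \<sigma>))"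
proof -
  interpret \<rho>: prob_space \<rho> by fact
  interpret gaussian_convolution \<rho> c R \<sigma>
  proof
    show "AE y in \<rho>. y \<in> cball c R"
      using supp_AE[OF assms(4)] by (rule eventually_mono) (use assms(5) in blast)
  qed (use assms \<rho>.emeasure_space_1 in auto)
  have v: "v t x =
      ((a t * time_deriv a t + \<sigma>\<^sup>2 * b t * time_deriv b t) / ((a t)\<^sup>2 + \<sigma>\<^sup>2 * (b t)\<^sup>2)) *\<^sub>R x +
      (((a t)\<^sup>2 * time_deriv b t - a t * time_deriv a t * b t) / ((a t)\<^sup>2 + \<sigma>\<^sup>2 * (b t)\<^sup>2)) *\<^sub>R
        posterior_mean (a t) (b t) x" if "0 < t" "t < 1" for t x
    using assms that
    by (intro velocity_field_eq[of M Z X1 a b v t]) (auto simp: interpolation_coeffs_def)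
  let ?K = "\<sigma> / sqrt ((a 0)\<^sup>2 + \<sigma>\<^sup>2 * (b 0)\<^sup>2) *
        exp ((a 0)\<^sup>2 / ((a 0)\<^sup>2 + \<sigma>\<^sup>2 * (b 0)\<^sup>2) * (R\<^sup>2 / (2 * \<sigma>\<^sup>2)))"
  let ?K' = "sqrt ((a 0)\<^sup>2 / \<sigma>\<^sup>2 + (b 0)\<^sup>2)"
  have X: "\<And>x. X 1 differentiable (at x)" "?K-lipschitz_on UNIV (X 1)"
    using interpolation_flow_forward[OF assms(1) v assms(14)] by auto
  have Xrev: "\<And>x. Xrev 1 differentiable (at x)" "?K'-lipschitz_on UNIV (Xrev 1)"
    using interpolation_flow_backward[OF assms(1) v assms(15)] by auto
  have J: "spectral_norm (jacobian (X 1) (at x)) \<le> ?K" for x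
    using X by (rule spectral_norm_jacobian_le)
  have J': "spectral_norm (jacobian (Xrev 1) (at x)) \<le> ?K'" for x
    using Xrev by (rule spectral_norm_jacobian_le)
  have K: "?K = \<sigma> * exp (R\<^sup>2 / (2 * \<sigma>\<^sup>2))" "?K' = 1 / \<sigma>" if "a 0 = 1" "b 0 = 0"
    using that \<open>\<sigma> > 0\<close> by (simp_all add: real_sqrt_divide)
  have "spectral_norm (jacobian (X 1) (at x)) \<le> \<sigma> * exp (R\<^sup>2 / (2 * \<sigma>\<^sup>2))" if "a 0 = 1 \<and> b 0 = 0" for x
    using J[of x] K(1) that by simp
  moreover have "spectral_norm (jacobian (Xrev 1) (at x)) \<le> 1 / \<sigma>" if "a 0 = 1 \<and> b 0 = 0" for x
    using J'[of x] K(2) that by simp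
  \<comment> \<open>The estimates for the reversed flow hold on all of space and are restricted to
    the support of \<nu> only here.\<close>
  ultimately show ?thesis
    using X Xrev(1) lipschitz_on_subset[OF Xrev(2) subset_UNIV] J J' by blast
qed

end
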